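(* Let $\mathcal{X}$ be a separable Hilbert space and let $A\in\mathcal{L}(\mathcal{X})$ be a compact operator with infinite-dimensional range. (i) If the sequence of $s$-numbers of $A$ is not lacunary, then $\mathcal{WE}(A)=\mathcal{L}(\mathcal{X})$. (ii) If the sequence of $s$-numbers of $A$ is lacunary, then $\mathcal{WE}(A)$ coincides with the set of operators in $\mathcal{L}(\mathcal{X})$ for which $\ker A$ is an invariant subspace.
   Context: $\mathcal{E}(A)=\{T\in\mathcal{L}(\mathcal{X}): \|ATx\|\ge\|Ax\|\ \text{for all } x\in\mathcal{X}\}$, and $\mathcal{WE}(A)$ is the closure of $\mathcal{E}(A)$ in the weak operator topology of $\mathcal{L}(\mathcal{X})$. The $s$-numbers $\{s_n(A)\}_{n=1}^\infty$ of a compact operator $A$ are the eigenvalues of $(A^*A)^{1/2}$ in non-increasing order, counted with multiplicity. A non-increasing sequence of positive numbers $a_n\to 0$ is lacunary if $\liminf_{n\to\infty}a_{n+1}/a_n=0$. *)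

theory Defs
  imports "HOL-Analysis.Analysis"
begin

text \<open>
  Scalar fields. A type of class \<open>real_or_complex\<close> comes with an isometric embedding of real
  fields into \<open>complex\<close>; its range is either the real line or all of \<open>complex\<close>
  (lemma \<open>range_to_complex\<close>), so that the class captures exactly the two usual scalar fields.
\<close>

class real_or_complex = real_normed_field +
  fixes to_complex :: "'a \<Rightarrow> complex"
  assumes to_complex_add: "to_complex (a + b) = to_complex a + to_complex b"
    and to_complex_mult: "to_complex (a * b) = to_complex a * to_complex b"
    and to_complex_scaleR: "to_complex (r *\<^sub>R a) = r *\<^sub>R to_complex a"
    and to_complex_one: "to_complex 1 = 1"
    and norm_to_complex: "norm (to_complex a) = norm a"

instantiation real :: real_or_complex
begin
definition to_complex_real :: "real \<Rightarrow> complex" where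
  "to_complex_real = complex_of_real"
instance
  by standard (simp_all add: to_complex_real_def scaleR_conv_of_real)
end

instantiation complex :: real_or_complex
begin
definition to_complex_complex :: "complex \<Rightarrow> complex" where
  "to_complex_complex z = z"
instance
  by standard (simp_all add: to_complex_complex_def)
end

lemma to_complex_of_real: "to_complex (of_real r) = of_real r"
  by (simp add: of_real_def to_complex_scaleR to_complex_one)

lemma range_to_complex:
  "range (to_complex :: 'k::real_or_complex \<Rightarrow> complex) = \<real> \<or>
   range (to_complex :: 'k \<Rightarrow> complex) = UNIV"
proof (cases "\<exists>a::'k. Im (to_complex a) \<noteq> 0")
  case True
  then obtain a :: 'k where a: "Im (to_complex a) \<noteq> 0" by blast
  have "z \<in> range (to_complex :: 'k \<Rightarrow> complex)" for z
  proof -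
    define t where "t = Im z / Im (to_complex a)"
    define r where "r = Re z - t * Re (to_complex a)"
    have "z = to_complex (t *\<^sub>R a + of_real r)"
      unfolding to_complex_add to_complex_scaleR to_complex_of_real
      using a by (simp add: complex_eq_iff t_def r_def)
    then show ?thesis by blast
  qed
  then show ?thesis by blast
next
  case False
  then have "range (to_complex :: 'k \<Rightarrow> complex) \<subseteq> \<real>"
    by (auto simp: complex_is_Real_iff)
  moreover have "\<real> \<subseteq> range (to_complex :: 'k \<Rightarrow> complex)"
    by (auto elim!: Reals_cases) (metis rangeI to_complex_of_real)
  ultimately show ?thesis by blast
qed

text \<open>
  A Hilbert space over the field \<open>'k\<close>, with inner product \<open>ip\<close>, linear in the first argument.
  Completeness and the norm come from the type class of \<open>'a\<close>: the real part of \<open>ip\<close>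
  is the real inner product of \<open>'a\<close>, so that \<open>ip x x\<close> is the square of \<open>norm x\<close>.
\<close>

locale hilbert_space = vector_space scale
  for scale :: "'k::real_or_complex \<Rightarrow> 'a::{real_inner,complete_space} \<Rightarrow> 'a" +
  fixes ip :: "'a \<Rightarrow> 'a \<Rightarrow> 'k"
  assumes scale_of_real: "scale (of_real r) x = r *\<^sub>R x"
    and ip_add_left: "ip (x + y) z = ip x z + ip y z"
    and ip_scale_left: "ip (scale c x) y = c * ip x y"
    and ip_commute: "to_complex (ip y x) = cnj (to_complex (ip x y))"
    and Re_ip: "Re (to_complex (ip x y)) = inner x y"
begin

lemma ip_self: "ip x x = of_real ((norm x)\<^sup>2)"
proof -
  have "to_complex (ip x x) = of_real ((norm x)\<^sup>2)"
    using ip_commute[of x x] Re_ip[of x x]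
    by (simp add: complex_eq_iff power2_norm_eq_inner)
  then have "to_complex (ip x x + (- 1) *\<^sub>R of_real ((norm x)\<^sup>2)) = 0"
    by (simp only: to_complex_add to_complex_scaleR to_complex_of_real) simp
  then have "norm (ip x x + (- 1) *\<^sub>R of_real ((norm x)\<^sup>2)) = 0"
    by (metis norm_to_complex norm_zero)
  then show ?thesis by simp
qed

definition L :: "('a \<Rightarrow> 'a) set" where
  "L = {T. bounded_linear T \<and> (\<forall>c x. T (scale c x) = scale c (T x))}"

definition ker :: "('a \<Rightarrow> 'a) \<Rightarrow> 'a set" where
  "ker A = {x. A x = 0}"

definition invariant_under :: "('a \<Rightarrow> 'a) \<Rightarrow> 'a set \<Rightarrow> bool" where
  "invariant_under T V \<longleftrightarrow> subspace V \<and> T ` V \<subseteq> V"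

definition compact_operator :: "('a \<Rightarrow> 'a) \<Rightarrow> bool" where
  "compact_operator A \<longleftrightarrow> A \<in> L \<and> compact (closure (A ` cball 0 1))"

definition finite_dimensional :: "'a set \<Rightarrow> bool" where
  "finite_dimensional V \<longleftrightarrow> (\<exists>B. finite B \<and> V \<subseteq> span B)"

text \<open>
  Here \<open>euclidean\<close> is the topology of pointwise convergence on \<open>'a \<times> 'a \<Rightarrow> 'k\<close>, so this is the
  coarsest topology on \<open>L\<close> that makes all \<open>T \<mapsto> ip (T x) y\<close> continuous.
\<close>

definition weak_operator_topology :: "('a \<Rightarrow> 'a) topology" where
  "weak_operator_topology = pullback_topology L (\<lambda>T (x, y). ip (T x) y) euclidean"

definition E :: "('a \<Rightarrow> 'a) \<Rightarrow> ('a \<Rightarrow> 'a) set" where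
  "E A = {T \<in> L. \<forall>x. norm (A (T x)) \<ge> norm (A x)}"

definition WE :: "('a \<Rightarrow> 'a) \<Rightarrow> ('a \<Rightarrow> 'a) set" where
  "WE A = weak_operator_topology closure_of E A"

definition adj :: "('a \<Rightarrow> 'a) \<Rightarrow> 'a \<Rightarrow> 'a" where
  "adj A = (THE B. \<forall>x y. ip (A x) y = ip x (B y))"

text \<open>Over the reals self-adjointness does not follow from the condition on the quadratic form.\<close>

definition positive_operator :: "('a \<Rightarrow> 'a) \<Rightarrow> bool" where
  "positive_operator P \<longleftrightarrow> P \<in> L \<and> (\<forall>x y. ip (P x) y = ip x (P y)) \<and>
     (\<forall>x. \<exists>r\<ge>0. ip (P x) x = of_real r)"

definition sqrt_operator :: "('a \<Rightarrow> 'a) \<Rightarrow> 'a \<Rightarrow> 'a" where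
  "sqrt_operator B = (THE P. positive_operator P \<and> P \<circ> P = B)"

definition eigenspace :: "('a \<Rightarrow> 'a) \<Rightarrow> 'k \<Rightarrow> 'a set" where
  "eigenspace P c = {x. P x = scale c x}"

text \<open>
  The \<open>s\<close>-numbers of a compact operator, indexed from \<open>0\<close>: the non-increasing sequence in which
  every \<open>t > 0\<close> occurs as often as the dimension of the \<open>t\<close>-eigenspace of \<open>(A\<^sup>*A)\<^sup>1\<^sup>/\<^sup>2\<close>
  (not at all if \<open>t\<close> is not an eigenvalue). It is padded with zeros if \<open>A\<close> has finite rank;
  if \<open>A\<close> has infinite rank, it consists of the positive eigenvalues only, whether or not
  \<open>ker A\<close> is trivial.
\<close>

definition s_number :: "('a \<Rightarrow> 'a) \<Rightarrow> nat \<Rightarrow> real" where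
  "s_number A = (THE s. decseq s \<and> (\<forall>n. s n \<ge> 0) \<and>
     (\<forall>t>0. finite {n. s n = t} \<and>
        card {n. s n = t} = dim (eigenspace (sqrt_operator (adj A \<circ> A)) (of_real t))))"

end

text \<open>Meant for non-increasing sequences of positive numbers that tend to \<open>0\<close>.\<close>

definition lacunary :: "(nat \<Rightarrow> real) \<Rightarrow> bool" where
  "lacunary a \<longleftrightarrow> liminf (\<lambda>n. ereal (a (Suc n) / a n)) = 0"

text \<open>Every real Hilbert space is an instance, and so is the complex line.\<close>

lemma hilbert_space_real:
  "hilbert_space (scaleR :: real \<Rightarrow> 'a::{real_inner,complete_space} \<Rightarrow> 'a) inner"
  by unfold_locales
    (simp_all add: to_complex_real_def inner_commute algebra_simps)

lemma hilbert_space_complex: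
  "hilbert_space ((*) :: complex \<Rightarrow> complex \<Rightarrow> complex) (\<lambda>x y. x * cnj y)"
  by unfold_locales
    (simp_all add: to_complex_complex_def inner_complex_def algebra_simps scaleR_conv_of_real)

end

(*
  A compact operator A of infinite rank has a singular value decomposition: orthonormal e_n with
  ip (A x) (A e_n) = s_n^2 ip x e_n, ker A being the orthogonal complement of the e_n.

  If s_(n+1) >= c s_n for all n, then for every finite set H some V with values orthogonal to H
  satisfies norm (A (V x)) = norm (A x): the singular values of A on the orthogonal complement of
  H are at least c^|H| s_n. If P is the projection onto the span of a finite set G, and VX is
  orthogonal to G and to A* A G, then P T + V lies in E(A) and has the same matrix coefficients
  against G as T.

  If T only leaves ker A invariant, T can still be matched exactly on finite sets F, G: on the
  orthogonal complement of ker A, take a large multiple of the identity on a complement of finite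
  codimension that is given by functionals x |-> ip (A x) q, and on F add to T a large map into
  the orthogonal complement of G. Functionals of this form are bounded by norm (A x), which
  makes the sum a member of E(A).

  Conversely, if S is in E(A) and maps some x0 in ker A outside ker A, then norm (A (S x)) is at
  least a constant times s_n norm x on the (n+2)-dimensional span of x0, e_0, ..., e_n. This span
  contains a nonzero x with S x orthogonal to e_0, ..., e_n, so s_(n+1) >= c s_n.
*)

theory Submission
  imports Defs
begin

section \<open>Real sequences: level sets and lacunarity\<close>

text \<open>For small \<open>t\<close> of the sign of \<open>p\<close> the linear term would
  dominate the quadratic one. This evaluates the first variation at a maximizer.\<close>

lemma linear_term_zero:
  fixes p D :: real
  assumes "\<And>t. 2 * t * p \<le> t\<^sup>2 * D"
  shows "p = 0"
proof (rule ccontr)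
  assume "p \<noteq> 0"
  \<comment> \<open>Chosen so that \<open>t\<^sup>2 * (\<bar>D\<bar> + 1)\<close> equals
    \<open>t * p\<close>, half of the left side.\<close>
  define t where "t = p / (\<bar>D\<bar> + 1)"
  have "2 * t * p \<le> t\<^sup>2 * D" by (rule assms)
  also have "\<dots> \<le> t\<^sup>2 * (\<bar>D\<bar> + 1)" by (intro mult_left_mono) auto
  also have "\<dots> = t * p"
    by (simp add: t_def power2_eq_square add_nonneg_pos)
  finally have "t * p \<le> 0" by linarith
  moreover have "t * p = p\<^sup>2 / (\<bar>D\<bar> + 1)" by (simp add: t_def power2_eq_square)
  moreover have "p\<^sup>2 / (\<bar>D\<bar> + 1) > 0" using \<open>p \<noteq> 0\<close> by (intro divide_pos_pos) auto
  ultimately show False by simp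
qed

text \<open>As \<open>v\<close> decreases and is already below the level \<open>u n\<close> at
  \<open>n\<close>, it attains that level only before \<open>n\<close>, where \<open>u\<close>
  agrees with it. But \<open>u\<close> attains it at \<open>n\<close> as well, so its count is
  larger.\<close>

lemma level_sets_less_False:
  fixes u v :: "nat \<Rightarrow> real"
  assumes "decseq v" "v n < u n" "\<And>i. i < n \<Longrightarrow> u i = v i"
    and "finite {i. u i = u n}" "card {i. u i = u n} = card {i. v i = u n}"
  shows False
proof -
  have "i < n" if "v i = u n" for i
    using that assms(2) decseqD[OF assms(1), of n i] by (cases "i < n") auto
  then have "{i. v i = u n} \<subseteq> {i. u i = u n}" using assms(3) by auto
  moreover have "n \<in> {i. u i = u n}" "n \<notin> {i. v i = u n}" using assms(2) by auto
  ultimately have "{i. v i = u n} \<subset> {i. u i = u n}" by blast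
  from psubset_card_mono[OF assms(4) this] assms(5) show False by simp
qed

text \<open>At a first index of disagreement the larger of the two values is positive, so its
  multiplicities in both sequences can be compared. This supplies the uniqueness behind the
  \<open>THE\<close> in \<open>s_number\<close>.\<close>

lemma decseq_eqI_level_sets:
  fixes u v :: "nat \<Rightarrow> real"
  assumes "decseq u" "\<And>n. u n \<ge> 0" "decseq v" "\<And>n. v n \<ge> 0"
    and "\<And>t. t > 0 \<Longrightarrow> finite {n. u n = t}" "\<And>t. t > 0 \<Longrightarrow> finite {n. v n = t}"
    and card: "\<And>t. t > 0 \<Longrightarrow> card {n. u n = t} = card {n. v n = t}"
  shows "u = v"
proof
  fix n show "u n = v n"
  proof (induction n rule: less_induct)
    case (less n)
    show ?case
    proof (rule linorder_cases[of "u n" "v n"])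
      assume "u n < v n"
      moreover from this have "v n > 0" using assms(2)[of n] by linarith
      ultimately show ?thesis
        using level_sets_less_False[OF assms(1), of n v] less assms(6) card by simp
    next
      assume "v n < u n"
      moreover from this have "u n > 0" using assms(4)[of n] by linarith
      ultimately show ?thesis
        using level_sets_less_False[OF assms(3), of n u] less assms(5) card by simp
    qed
  qed
qed

text \<open>The ratios are positive, so a positive lower bound for almost all of them extends to
  all. The uniform bound is the form in which lacunarity is used from here on.\<close>

lemma not_lacunary_iff:
  assumes pos: "\<And>n. s n > (0::real)"
  shows "\<not> lacunary s \<longleftrightarrow> (\<exists>c>0. \<forall>n. c * s n \<le> s (Suc n))"
proof
  define q where "q n = s (Suc n) / s n" for n
  have q_pos: "q n > 0" for n using pos by (simp add: q_def)
  assume "\<not> lacunary s"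
  then have "liminf (\<lambda>n. ereal (q n)) \<noteq> 0" by (simp add: lacunary_def q_def)
  moreover have "0 \<le> liminf (\<lambda>n. ereal (q n))"
    using q_pos by (intro Liminf_bounded) (simp add: less_imp_le)
  ultimately obtain c where c: "0 < ereal c" "ereal c < liminf (\<lambda>n. ereal (q n))"
    using ereal_dense2 by (metis order_le_less)
  then obtain N where N: "\<And>n. n \<ge> N \<Longrightarrow> c < q n"
    using less_LiminfD[OF c(2)] by (auto simp: eventually_sequentially)
  \<comment> \<open>The minimum also covers the finitely many ratios before \<open>N\<close>, about
    which the limit inferior says nothing.\<close>
  define d where "d = Min (insert c (q ` {..<N}))"
  have "d \<le> q n" for n
  proof (cases "n < N")
    case False
    have "d \<le> c" by (simp add: d_def)
    then show ?thesis using N[of n] False by simp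
  qed (simp add: d_def)
  moreover have "d > 0" using c q_pos by (auto simp: d_def)
  ultimately show "\<exists>c>0. \<forall>n. c * s n \<le> s (Suc n)"
    using pos by (intro exI[of _ d]) (simp add: q_def pos_le_divide_eq)
next
  assume "\<exists>c>0. \<forall>n. c * s n \<le> s (Suc n)"
  then obtain c where c: "c > 0" "\<And>n. c * s n \<le> s (Suc n)" by blast
  have "ereal c \<le> liminf (\<lambda>n. ereal (s (Suc n) / s n))"
    using c(2) pos by (intro Liminf_bounded) (simp add: pos_le_divide_eq)
  then show "\<not> lacunary s"
    using c(1) by (auto simp: lacunary_def)
qed

context hilbert_space
begin

subsection \<open>Inner products and bounded operators\<close>

lemma to_complex_zero [simp]: "to_complex (0::'k) = 0"
  using to_complex_of_real[of 0, where ?'a = 'k] by simp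

lemma to_complex_eq_iff [simp]: "to_complex (a::'k) = to_complex b \<longleftrightarrow> a = b"
proof
  assume "to_complex a = to_complex b"
  then have "to_complex (a + (-1) *\<^sub>R b) = 0"
    by (simp only: to_complex_add to_complex_scaleR) simp
  then have "norm (a + (-1) *\<^sub>R b) = 0"
    by (metis norm_to_complex norm_zero)
  then show "a = b" by simp
qed simp

lemma ip_zero_left [simp]: "ip 0 y = 0"
  using ip_scale_left[of 0 0 y] by simp

lemma ip_eq_zero_commute: "ip x y = 0 \<longleftrightarrow> ip y x = 0"
proof -
  have "ip x y = 0 \<longleftrightarrow> to_complex (ip x y) = to_complex (0::'k)"
    by (simp only: to_complex_eq_iff)
  also have "\<dots> \<longleftrightarrow> to_complex (ip y x) = to_complex (0::'k)"
    by (subst ip_commute) (simp del: to_complex_eq_iff)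
  finally show ?thesis by (simp only: to_complex_eq_iff)
qed

lemma ip_zero_right [simp]: "ip x 0 = 0"
  using ip_eq_zero_commute by simp

lemma norm_ip_commute: "norm (ip x y) = norm (ip y x)"
  by (metis complex_mod_cnj ip_commute norm_to_complex)

lemma ip_add_right: "ip x (y + z) = ip x y + ip x z"
proof -
  have "to_complex (ip x (y + z)) = to_complex (ip x y + ip x z)"
    by (simp add: ip_commute[of x] ip_add_left to_complex_add)
  then show ?thesis by (simp only: to_complex_eq_iff)
qed

lemma to_complex_ip_scale_right:
  "to_complex (ip x (scale c y)) = cnj (to_complex c) * to_complex (ip x y)"
  by (simp add: ip_commute[of x] ip_scale_left to_complex_mult)

lemma ip_scale_ip_right: "ip x (scale (ip y z) w) = ip z y * ip x w"
proof -
  have "to_complex (ip x (scale (ip y z) w)) = to_complex (ip z y * ip x w)"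
    by (simp add: to_complex_ip_scale_right ip_commute[of z] to_complex_mult)
  then show ?thesis by (simp only: to_complex_eq_iff)
qed

lemma ip_scaleR_left: "ip (r *\<^sub>R x) y = of_real r * ip x y"
  by (metis ip_scale_left scale_of_real)

lemma ip_scaleR_right: "ip x (r *\<^sub>R y) = of_real r * ip x y"
proof -
  have "to_complex (ip x (scale (of_real r) y)) = to_complex (of_real r * ip x y)"
    by (simp only: to_complex_ip_scale_right to_complex_mult to_complex_of_real) simp
  then show ?thesis by (simp only: to_complex_eq_iff scale_of_real)
qed

lemma ip_minus_left [simp]: "ip (- x) y = - ip x y"
  using ip_scaleR_left[of "-1" x y] by simp

lemma ip_minus_right [simp]: "ip x (- y) = - ip x y"
  using ip_scaleR_right[of x "-1" y] by simp

lemma ip_diff_left: "ip (x - y) z = ip x z - ip y z"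
  using ip_add_left[of x "- y" z] by simp

lemma ip_diff_right: "ip x (y - z) = ip x y - ip x z"
  using ip_add_right[of x y "- z"] by simp

lemma ip_sum_left: "ip (\<Sum>i\<in>I. f i) y = (\<Sum>i\<in>I. ip (f i) y)"
  by (induction I rule: infinite_finite_induct) (simp_all add: ip_add_left)

lemma ip_sum_right: "ip x (\<Sum>i\<in>I. f i) = (\<Sum>i\<in>I. ip x (f i))"
  by (induction I rule: infinite_finite_induct) (simp_all add: ip_add_right)

lemma ip_self_eq_zero [simp]: "ip x x = 0 \<longleftrightarrow> x = 0"
  by (simp add: ip_self)

lemma ip_mult_commute: "ip x y * ip y x = of_real ((norm (ip x y))\<^sup>2)"
proof -
  have "to_complex (ip x y * ip y x) = to_complex (of_real ((norm (ip x y))\<^sup>2) :: 'k)"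
    using complex_norm_square[of "to_complex (ip x y)"] ip_commute[of y x]
    by (simp only: to_complex_mult to_complex_of_real norm_to_complex)
  then show ?thesis by (simp only: to_complex_eq_iff)
qed

lemma norm_scale [simp]: "norm (scale c x) = norm c * norm x"
proof -
  have "to_complex (ip (scale c x) (scale c x)) =
      of_real ((norm c)\<^sup>2) * of_real ((norm x)\<^sup>2)"
    using complex_norm_square[of "to_complex c"]
    by (simp only: ip_scale_left to_complex_mult to_complex_ip_scale_right)
      (simp only: ip_self to_complex_of_real norm_to_complex mult.assoc)
  then have "of_real ((norm (scale c x))\<^sup>2) = (of_real ((norm c * norm x)\<^sup>2) :: complex)"
    by (simp only: ip_self to_complex_of_real) (simp add: power_mult_distrib)
  then have "(norm (scale c x))\<^sup>2 = (norm c * norm x)\<^sup>2"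
    by (simp only: of_real_eq_iff)
  then show ?thesis by (simp add: power2_eq_iff_nonneg)
qed

lemma norm_ip_le: "norm (ip x y) \<le> norm x * norm y"
proof (cases "ip x y = 0")
  case False
  \<comment> \<open>A unimodular factor that turns \<open>ip x y\<close> into its absolute value, so
    that the real Cauchy-Schwarz inequality applies.\<close>
  define c where "c = of_real (norm (ip x y)) / ip x y"
  have "norm c = 1" using False by (simp add: c_def norm_divide)
  have "ip (scale c x) y = of_real (norm (ip x y))"
    using False by (simp add: ip_scale_left c_def)
  then have "norm (ip x y) = inner (scale c x) y"
    by (metis Re_complex_of_real Re_ip to_complex_of_real)
  also have "\<dots> \<le> norm (scale c x) * norm y"
    by (rule norm_cauchy_schwarz)
  finally show ?thesis using \<open>norm c = 1\<close> by simp
qed simp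

lemma norm_add_square_orthogonal:
  assumes "ip x y = 0"
  shows "(norm (x + y))\<^sup>2 = (norm x)\<^sup>2 + (norm y)\<^sup>2"
proof -
  have "inner x y = 0" using Re_ip[of x y] assms by simp
  then show ?thesis
    by (simp add: power2_norm_eq_inner inner_add_left inner_add_right inner_commute)
qed

lemma norm_sum_square_orthogonal:
  assumes "finite I" and "\<And>i j. i \<in> I \<Longrightarrow> j \<in> I \<Longrightarrow> i \<noteq> j \<Longrightarrow> ip (f i) (f j) = 0"
  shows "(norm (\<Sum>i\<in>I. f i))\<^sup>2 = (\<Sum>i\<in>I. (norm (f i))\<^sup>2)"
  using assms
proof (induction I)
  case (insert i I)
  have "ip (f i) (sum f I) = 0"
    unfolding ip_sum_right using insert by (intro sum.neutral) auto
  then show ?case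
    using insert by (simp add: norm_add_square_orthogonal)
qed simp

lemma bounded_linear_ip_left: "bounded_linear (\<lambda>x. ip x y)"
  by (rule bounded_linear_intro[where K = "norm y"])
    (simp_all add: ip_add_left ip_scaleR_left scaleR_conv_of_real norm_ip_le)

lemma bounded_linear_ip_right: "bounded_linear (ip x)"
  by (rule bounded_linear_intro[where K = "norm x"])
    (simp_all add: ip_add_right ip_scaleR_right scaleR_conv_of_real, metis mult.commute norm_ip_le)

lemma L_iff_linear: "T \<in> L \<longleftrightarrow> bounded_linear T \<and> Vector_Spaces.linear scale scale T"
  unfolding L_def
  using vector_space_axioms
  by (auto simp: Vector_Spaces.linear_iff dest: bounded_linear.linear real_vector.linear_add)

lemma L_bounded_linear: "T \<in> L \<Longrightarrow> bounded_linear T"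
  by (simp add: L_def)

lemma L_linear: "T \<in> L \<Longrightarrow> Vector_Spaces.linear scale scale T"
  by (simp add: L_iff_linear)

lemma L_scale: "T \<in> L \<Longrightarrow> T (scale c x) = scale c (T x)"
  by (simp add: L_def)

lemma L_id: "(\<lambda>x. x) \<in> L"
  by (simp add: L_def bounded_linear_ident)

lemma L_zero: "(\<lambda>x. 0) \<in> L"
  by (simp add: L_def)

lemma L_add: "S \<in> L \<Longrightarrow> T \<in> L \<Longrightarrow> (\<lambda>x. S x + T x) \<in> L"
  by (simp add: L_def bounded_linear_add scale_right_distrib)

lemma L_diff: "S \<in> L \<Longrightarrow> T \<in> L \<Longrightarrow> (\<lambda>x. S x - T x) \<in> L"
  by (simp add: L_def bounded_linear_sub scale_right_diff_distrib)

lemma L_scaleR: "T \<in> L \<Longrightarrow> (\<lambda>x. r *\<^sub>R T x) \<in> L"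
  unfolding L_def
  by (simp add: bounded_linear_scaleR_right[THEN bounded_linear_compose])
    (metis mult.commute scale_of_real scale_scale)

lemma L_comp: "S \<in> L \<Longrightarrow> T \<in> L \<Longrightarrow> (\<lambda>x. S (T x)) \<in> L"
  by (simp add: L_def bounded_linear_compose)

lemma L_sum: "(\<And>i. i \<in> I \<Longrightarrow> T i \<in> L) \<Longrightarrow> (\<lambda>x. \<Sum>i\<in>I. T i x) \<in> L"
  by (induction I rule: infinite_finite_induct) (simp_all add: L_zero L_add)

lemma L_rank_one: "T \<in> L \<Longrightarrow> (\<lambda>x. scale (ip (T x) q) v) \<in> L"
  unfolding L_def
proof (clarify, intro conjI allI)
  assume T: "bounded_linear T" "\<forall>c x. T (scale c x) = scale c (T x)"
  have "bounded_linear (\<lambda>c. scale c v)"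
    by (rule bounded_linear_intro[where K = "norm v"])
      (simp_all add: scale_left_distrib scaleR_conv_of_real flip: scale_of_real)
  from bounded_linear_compose[OF this bounded_linear_compose[OF bounded_linear_ip_left T(1)]]
  show "bounded_linear (\<lambda>x. scale (ip (T x) q) v)" by simp
  show "scale (ip (T (scale c x)) q) v = scale c (scale (ip (T x) q) v)" for c x
    by (simp add: T ip_scale_left)
qed

section \<open>Dimension counts and Gram-Schmidt orthonormalization\<close>

lemma independent_orthogonal:
  assumes "0 \<notin> B" and "\<And>b c. b \<in> B \<Longrightarrow> c \<in> B \<Longrightarrow> b \<noteq> c \<Longrightarrow> ip b c = 0"
  shows "independent B"
  unfolding independent_explicit_finite_subsets
proof (intro allI impI ballI)
  fix S u v
  assume S: "S \<subseteq> B" "finite S" "(\<Sum>v\<in>S. scale (u v) v) = 0" and v: "v \<in> S"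
  have "0 = ip (\<Sum>v\<in>S. scale (u v) v) v"
    by (simp add: S)
  also have "\<dots> = (\<Sum>w\<in>S. if w = v then u v * ip v v else 0)"
    unfolding ip_sum_left ip_scale_left using assms(2) S(1) v by (intro sum.cong) auto
  also have "\<dots> = u v * ip v v"
    using S v by simp
  finally show "u v = 0"
    using assms(1) S(1) v by auto
qed

text \<open>A dimension count: a linear map from the span of \<open>B\<close> into the span of the
  smaller set \<open>C\<close> cannot be injective.\<close>

lemma exists_orthogonal_in_span:
  assumes T: "T \<in> L" and B: "independent B" "finite B" and C: "finite C" "card C < card B"
  obtains x where "x \<in> span B" "x \<noteq> 0" "\<And>c. c \<in> C \<Longrightarrow> ip (T x) c = 0"
proof -
  define f where "f x = (\<Sum>c\<in>C. scale (ip (T x) c) c)" for x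
  have "f \<in> L"
    unfolding f_def by (intro L_sum L_rank_one T)
  then interpret f: Vector_Spaces.linear scale scale f
    by (rule L_linear)
  have orth: "ip (T x) c = 0" if "f x = 0" "c \<in> C" for x c
  proof -
    \<comment> \<open>Pairing \<open>f x\<close> with \<open>T x\<close> gives a sum of squares, so
      all coefficients vanish even if \<open>C\<close> is linearly dependent.\<close>
    have "0 = ip (f x) (T x)"
      using that by simp
    also have "\<dots> = (\<Sum>c\<in>C. of_real ((norm (ip (T x) c))\<^sup>2))"
      by (simp add: f_def ip_sum_left ip_scale_left ip_mult_commute)
    finally have "of_real (\<Sum>c\<in>C. (norm (ip (T x) c))\<^sup>2) = (0 :: 'k)"
      by simp
    then have "(\<Sum>c\<in>C. (norm (ip (T x) c))\<^sup>2) = 0"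
      by (simp only: of_real_eq_0_iff)
    then show ?thesis
      using C(1) that(2) by (simp add: sum_nonneg_eq_0_iff)
  qed
  have "\<not> inj_on f (span B)"
  proof
    assume inj: "inj_on f (span B)"
    have "f ` B \<subseteq> span C"
      unfolding f_def by (intro image_subsetI span_sum span_scale span_base)
    then have "card (f ` B) \<le> card C"
      using independent_span_bound C(1) f.independent_injective_image[OF B(1) inj] by blast
    moreover have "card (f ` B) = card B"
      using inj span_superset by (intro card_image) (rule inj_on_subset)
    ultimately show False using C(2) by simp
  qed
  then obtain x where "x \<in> span B" "f x = 0" "x \<noteq> 0"
    using f.inj_on_iff_eq_0[OF subspace_span] by blast
  with orth that show ?thesis by blast
qed

text \<open>Orthonormality in the semi-inner product \<open>ip (A x) (A y)\<close>. The identity in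
  place of \<open>A\<close> gives the ordinary notion, so one Gram-Schmidt process serves
  both.\<close>

definition orthonormal_for :: "('a \<Rightarrow> 'a) \<Rightarrow> 'a set \<Rightarrow> bool" where
  "orthonormal_for A C \<longleftrightarrow> (\<forall>c\<in>C. \<forall>d\<in>C. ip (A c) (A d) = (if c = d then 1 else 0))"

text \<open>For \<open>C\<close> orthonormal in that sense, the orthogonal projection onto its
  span.\<close>

definition expand_for :: "('a \<Rightarrow> 'a) \<Rightarrow> 'a set \<Rightarrow> 'a \<Rightarrow> 'a" where
  "expand_for A C x = (\<Sum>c\<in>C. scale (ip (A x) (A c)) c)"

lemma L_expand_for: "A \<in> L \<Longrightarrow> expand_for A C \<in> L"
  unfolding expand_for_def[abs_def] by (intro L_sum L_rank_one)

lemma L_map_sum: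
  assumes "A \<in> L"
  shows "A (\<Sum>c\<in>C. scale (a c) (g c)) = (\<Sum>c\<in>C. scale (a c) (A (g c)))"
  using assms by (simp add: L_def bounded_linear.linear real_vector.linear_sum)

lemma L_map_diff: "A \<in> L \<Longrightarrow> A (x - y) = A x - A y"
  by (simp add: L_def bounded_linear.linear real_vector.linear_diff)

lemma L_map_add: "A \<in> L \<Longrightarrow> A (x + y) = A x + A y"
  by (simp add: L_def bounded_linear.linear real_vector.linear_add)

lemma L_map_zero: "A \<in> L \<Longrightarrow> A 0 = 0"
  by (simp add: L_def bounded_linear.linear real_vector.linear_0)

lemma L_map_scaleR: "A \<in> L \<Longrightarrow> A (r *\<^sub>R x) = r *\<^sub>R A x"
  by (simp add: L_def bounded_linear.linear real_vector.linear_scale)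

lemma ip_expand_for:
  assumes "A \<in> L" "finite C" "orthonormal_for A C" "d \<in> C"
  shows "ip (A (expand_for A C x)) (A d) = ip (A x) (A d)"
proof -
  have "ip (A (expand_for A C x)) (A d) =
      (\<Sum>c\<in>C. if c = d then ip (A x) (A d) else 0)"
    unfolding expand_for_def L_map_sum[OF assms(1)] ip_sum_left ip_scale_left
    using assms(3,4) by (intro sum.cong) (auto simp: orthonormal_for_def)
  then show ?thesis using assms by simp
qed

text \<open>Induction on \<open>F\<close> with the residual \<open>y\<close> of the new vector. The
  form degenerates on \<open>ker A\<close>: a residual in \<open>ker A\<close> is dropped rather
  than normalized, and vectors of \<open>F\<close> are recovered only modulo
  \<open>ker A\<close>.\<close>

lemma gram_schmidt:
  assumes A: "A \<in> L" and "finite F"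
  obtains C where "finite C" "C \<subseteq> span F" "orthonormal_for A C"
    "\<And>x. x \<in> F \<Longrightarrow> A (x - expand_for A C x) = 0"
proof -
  have "\<exists>C. finite C \<and> C \<subseteq> span F \<and> orthonormal_for A C \<and>
      (\<forall>x\<in>F. A (x - expand_for A C x) = 0)"
    using \<open>finite F\<close>
  proof (induction F)
    case empty
    show ?case by (rule exI[of _ "{}"]) (simp add: orthonormal_for_def)
  next
    case (insert x F)
    then obtain C where C: "finite C" "C \<subseteq> span F" "orthonormal_for A C"
      and F: "\<And>x. x \<in> F \<Longrightarrow> A (x - expand_for A C x) = 0" by blast
    have C': "C \<subseteq> span (insert x F)"
      using C(2) span_mono[of F "insert x F"] by blast
    define y where "y = x - expand_for A C x"
    have y: "ip (A y) (A c) = 0" if "c \<in> C" for c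
      using that C by (simp add: y_def L_map_diff[OF A] ip_diff_left ip_expand_for[OF A])
    have y_span: "y \<in> span (insert x F)"
      unfolding y_def expand_for_def
      using C' by (intro span_diff span_sum span_scale) (auto intro: span_base)
    show ?case
    proof (cases "A y = 0")
      case True
      then show ?thesis
        using C C' F by (intro exI[of _ C]) (auto simp: y_def)
    next
      case False
      define d where "d = (1 / norm (A y)) *\<^sub>R y"
      have Ad: "A d = (1 / norm (A y)) *\<^sub>R A y"
        by (simp add: d_def L_map_scaleR[OF A])
      have dd: "ip (A d) (A d) = 1"
        using False by (simp add: ip_self Ad)
      have dc: "ip (A d) (A c) = 0" "ip (A c) (A d) = 0" if "c \<in> C" for c
        using y[OF that] ip_eq_zero_commute[of "A y" "A c"]
        by (simp_all add: Ad ip_scaleR_left ip_scaleR_right)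
      have "d \<notin> C" using dc(1) dd by force
      have expand: "expand_for A (insert d C) z = scale (ip (A z) (A d)) d + expand_for A C z" for z
        using \<open>d \<notin> C\<close> C(1) by (simp add: expand_for_def)
      have expand_d: "ip (A (expand_for A C z)) (A d) = 0" for z
        unfolding expand_for_def L_map_sum[OF A] ip_sum_left ip_scale_left
        by (intro sum.neutral) (simp add: dc)
      have "ip (A x) (A d) = ip (A y) (A d)"
        by (simp add: y_def L_map_diff[OF A] ip_diff_left expand_d)
      also have "\<dots> = of_real (norm (A y))"
        using False by (simp add: Ad ip_scaleR_right ip_self power2_eq_square)
      finally have "scale (ip (A x) (A d)) d = y"
        using False by (simp add: scale_of_real d_def)
      then have "x - expand_for A (insert d C) x = 0"
        by (simp add: expand y_def)
      \<comment> \<open>Modulo \<open>ker A\<close> an old vector is a combination of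
        \<open>C\<close>, so its coefficient at \<open>d\<close> is zero and its expansion does not
        change.\<close>
      moreover have "A (z - expand_for A (insert d C) z) = 0" if "z \<in> F" for z
      proof -
        have "ip (A z) (A d) = ip (A (z - expand_for A C z)) (A d)"
          by (simp add: L_map_diff[OF A] ip_diff_left expand_d)
        also have "\<dots> = 0" by (simp add: F[OF that])
        finally show ?thesis by (simp add: expand F[OF that])
      qed
      moreover have "d \<in> span (insert x F)"
        unfolding d_def using y_span span_scale[OF y_span, of "of_real (1 / norm (A y))"]
        by (simp only: scale_of_real)
      ultimately show ?thesis
        using C C' dc dd \<open>d \<notin> C\<close>
        by (intro exI[of _ "insert d C"]) (auto simp: orthonormal_for_def L_map_zero[OF A])
    qed
  qed
  with that show ?thesis by blast
qed

text \<open>Transfers agreement of matrix coefficients from an orthonormal set \<open>C\<close> to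
  the vectors that \<open>C\<close> spans.\<close>

lemma ip_gram_schmidt_right:
  assumes "y - expand_for (\<lambda>x. x) C y = 0"
  shows "ip z y = (\<Sum>c\<in>C. ip c y * ip z c)"
proof -
  have "ip z y = ip z (expand_for (\<lambda>x. x) C y)" using assms by simp
  then show ?thesis by (simp add: expand_for_def ip_sum_right ip_scale_ip_right)
qed

section \<open>Infinite rank and extremal vectors of a compact operator\<close>

text \<open>Each \<open>x\<close> differs from its projection onto the span of \<open>H\<close> by a
  vector that \<open>A\<close> kills. Hence for infinite rank, finitely many orthogonality
  conditions always leave a vector outside \<open>ker A\<close>.\<close>

lemma finite_rank_if_zero_on_orthogonal:
  assumes A: "A \<in> L" and "finite H" and "\<And>w. (\<And>h. h \<in> H \<Longrightarrow> ip w h = 0) \<Longrightarrow> A w = 0"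
  shows "finite_dimensional (range A)"
proof -
  obtain C where C: "finite C" "orthonormal_for (\<lambda>x. x) C"
    and H: "\<And>x. x \<in> H \<Longrightarrow> x - expand_for (\<lambda>x. x) C x = 0"
    using gram_schmidt[OF L_id \<open>finite H\<close>] by metis
  have "A x \<in> span (A ` C)" for x
  proof -
    define w where "w = x - expand_for (\<lambda>x. x) C x"
    have w: "ip w c = 0" if "c \<in> C" for c
      using ip_expand_for[OF L_id C that] by (simp add: w_def ip_diff_left)
    have "ip w h = 0" if "h \<in> H" for h
    proof -
      have "ip h w = ip (expand_for (\<lambda>x. x) C h) w"
        using H[OF that] by simp
      also have "\<dots> = 0"
        unfolding expand_for_def ip_sum_left ip_scale_left
        using w ip_eq_zero_commute by (intro sum.neutral) auto
      finally show ?thesis using ip_eq_zero_commute by blast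
    qed
    then have "A w = 0" by (rule assms(3))
    then have "A x = (\<Sum>c\<in>C. scale (ip x c) (A c))"
      by (simp add: w_def L_map_diff[OF A] expand_for_def L_map_sum[OF A])
    also have "\<dots> \<in> span (A ` C)"
      by (intro span_sum span_scale span_base imageI)
    finally show ?thesis .
  qed
  then show ?thesis
    unfolding finite_dimensional_def using C(1) by (intro exI[of _ "A ` C"]) auto
qed

text \<open>
  No weak compactness is needed: along a maximizing sequence whose image converges, the
  parallelogram law makes the sequence itself Cauchy.
\<close>

lemma norm_attained_on_orthogonal:
  assumes A: "compact_operator A"
    and w: "\<And>h. h \<in> H \<Longrightarrow> ip w h = 0" "A w \<noteq> 0"
  obtains e where "\<And>h. h \<in> H \<Longrightarrow> ip e h = 0" "norm e = 1" "A e \<noteq> 0"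
    "\<And>x. (\<And>h. h \<in> H \<Longrightarrow> ip x h = 0) \<Longrightarrow> norm (A x) \<le> norm (A e) * norm x"
    "\<And>x. (\<And>h. h \<in> H \<Longrightarrow> ip x h = 0) \<Longrightarrow> ip x e = 0 \<Longrightarrow> ip (A x) (A e) = 0"
proof -
  have AL: "A \<in> L" and compact: "compact (closure (A ` cball 0 1))"
    using A by (auto simp: compact_operator_def)
  interpret A: bounded_linear A using AL by (rule L_bounded_linear)
  define W where "W = {x. \<forall>h\<in>H. ip x h = 0}"
  have W_scaleR: "r *\<^sub>R x \<in> W" if "x \<in> W" for r x
    using that by (simp add: W_def ip_scaleR_left)
  have W_scale: "scale c x \<in> W" if "x \<in> W" for c x
    using that by (simp add: W_def ip_scale_left)
  have W_add: "x + y \<in> W" if "x \<in> W" "y \<in> W" for x y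
    using that by (simp add: W_def ip_add_left)
  define S where "S = {norm (A x) | x. x \<in> W \<and> norm x = 1}"
  define M where "M = Sup S"
  obtain K where K: "\<And>x. norm (A x) \<le> norm x * K" using A.bounded by blast
  have bdd: "bdd_above S"
    by (rule bdd_aboveI[of _ K]) (auto simp: S_def intro: order_trans[OF K])
  have in_S: "norm (A ((1 / norm x) *\<^sub>R x)) \<in> S" if "x \<in> W" "x \<noteq> 0" for x
    unfolding S_def using that W_scaleR by fastforce
  have upper: "norm (A x) \<le> M * norm x" if "x \<in> W" for x
  proof (cases "x = 0")
    case False
    have "norm (A ((1 / norm x) *\<^sub>R x)) \<le> M"
      unfolding M_def using in_S[OF that False] bdd by (rule cSup_upper)
    then show ?thesis using False by (simp add: A.scaleR field_simps)
  qed (simp add: A.zero)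
  have "w \<in> W" "w \<noteq> 0" using w by (auto simp: W_def A.zero)
  then have "S \<noteq> {}" using in_S by blast
  have "M > 0"
  proof -
    have "0 < norm (A w)" using w by simp
    also have "\<dots> \<le> M * norm w" by (rule upper) fact
    finally show ?thesis using \<open>w \<noteq> 0\<close> by (simp add: zero_less_mult_iff)
  qed
  have "\<exists>x. x \<in> W \<and> norm x = 1 \<and> M - 1 / real (Suc n) < norm (A x)" for n
    using less_cSup_iff[OF \<open>S \<noteq> {}\<close> bdd, of "M - 1 / real (Suc n)"]
    by (auto simp: M_def S_def)
  then obtain X where X: "\<And>n. X n \<in> W" "\<And>n. norm (X n) = 1"
    "\<And>n. M - 1 / real (Suc n) < norm (A (X n))" by metis
  have lim_M: "(\<lambda>n. norm (A (X n))) \<longlonglongrightarrow> M"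
  proof (rule tendsto_sandwich)
    show "\<forall>\<^sub>F n in sequentially. M - 1 / real (Suc n) \<le> norm (A (X n))"
      using X(3) by (simp add: less_imp_le)
    show "\<forall>\<^sub>F n in sequentially. norm (A (X n)) \<le> M"
      using upper[OF X(1)] X(2) by simp
    show "(\<lambda>n. M - 1 / real (Suc n)) \<longlonglongrightarrow> M"
      using tendsto_diff[OF tendsto_const LIMSEQ_Suc[OF lim_1_over_n], of M] by simp
  qed simp
  have "\<forall>n. A (X n) \<in> closure (A ` cball 0 1)"
    using X(2) closure_subset[of "A ` cball 0 1"] by (force simp: dist_norm)
  with compact obtain y r where r: "strict_mono r" "((\<lambda>n. A (X n)) \<circ> r) \<longlonglongrightarrow> y"
    unfolding compact_def by metis
  define Z where "Z n = X (r n)" for n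
  have AZ: "(\<lambda>n. A (Z n)) \<longlonglongrightarrow> y" using r(2) by (simp add: Z_def o_def)
  have "norm y = M"
    using LIMSEQ_unique[OF tendsto_norm[OF AZ]] LIMSEQ_subseq_LIMSEQ[OF lim_M r(1)]
    by (simp add: Z_def o_def)
  have Z: "Z n \<in> W" "norm (Z n) = 1" for n by (simp_all add: Z_def X)
  have "Cauchy Z"
  proof (rule metric_CauchyI)
    fix \<epsilon> :: real assume "\<epsilon> > 0"
    \<comment> \<open>The bound by \<open>M\<close> keeps \<open>1 - d / M\<close> nonnegative for
      squaring; the other one makes the defect \<open>8 * d / M\<close> in the parallelogram law at
      most half of \<open>\<epsilon>\<^sup>2\<close>.\<close>
    define d where "d = min M (\<epsilon>\<^sup>2 * M / 16)"
    have d: "d > 0" "d \<le> M" "8 * d / M \<le> \<epsilon>\<^sup>2 / 2"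
      using \<open>M > 0\<close> \<open>\<epsilon> > 0\<close> by (auto simp: d_def field_simps min_def)
    obtain N where N: "\<And>n. n \<ge> N \<Longrightarrow> norm (A (Z n) - y) < d"
      using LIMSEQ_D[OF AZ d(1)] by blast
    have "dist (Z m) (Z n) < \<epsilon>" if "m \<ge> N" "n \<ge> N" for m n
    proof -
      \<comment> \<open>Both images are close to \<open>y\<close>, which has norm \<open>M\<close>,
        so their sum has norm close to \<open>2 * M\<close>. By maximality of \<open>M\<close> this
        forces \<open>norm (Z m + Z n)\<close> close to \<open>2\<close>.\<close>
      have "2 * M = norm ((A (Z m) + A (Z n)) - ((A (Z m) - y) + (A (Z n) - y)))"
        using \<open>norm y = M\<close> by (simp flip: scaleR_2)
      also have "\<dots> \<le> norm (A (Z m) + A (Z n)) + (norm (A (Z m) - y) + norm (A (Z n) - y))"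
        by (meson add_left_mono norm_triangle_ineq norm_triangle_ineq4 order_trans)
      also have "norm (A (Z m) + A (Z n)) \<le> M * norm (Z m + Z n)"
        using upper[OF W_add[OF Z(1) Z(1)]] by (simp add: A.add)
      finally have "2 * (M - d) \<le> M * norm (Z m + Z n)"
        using N[OF that(1)] N[OF that(2)] by simp
      then have "2 * (1 - d / M) \<le> norm (Z m + Z n)"
        using \<open>M > 0\<close> by (simp add: field_simps)
      then have "(2 * (1 - d / M))\<^sup>2 \<le> (norm (Z m + Z n))\<^sup>2"
        using d \<open>M > 0\<close> by (intro power_mono) (auto simp: field_simps)
      moreover have "(2 * (1 - d / M))\<^sup>2 = 4 - 8 * d / M + (2 * d / M)\<^sup>2"
        by (simp add: power2_eq_square algebra_simps)
      moreover have "(2 * d / M)\<^sup>2 \<ge> 0" by simp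
      ultimately have "4 - 8 * d / M \<le> (norm (Z m + Z n))\<^sup>2" by linarith
      moreover have "(norm (Z m - Z n))\<^sup>2 + (norm (Z m + Z n))\<^sup>2 = 4"
      proof -
        have "inner (Z m) (Z m) = 1" "inner (Z n) (Z n) = 1"
          using Z(2) by (simp_all flip: power2_norm_eq_inner)
        then show ?thesis
          by (simp add: power2_norm_eq_inner inner_add_left inner_add_right inner_diff_left
              inner_diff_right inner_commute)
      qed
      ultimately have "(norm (Z m - Z n))\<^sup>2 \<le> \<epsilon>\<^sup>2 / 2" using d(3) by linarith
      also have "\<dots> < \<epsilon>\<^sup>2" using \<open>\<epsilon> > 0\<close> by simp
      finally show ?thesis
        using \<open>\<epsilon> > 0\<close> by (simp add: dist_norm power_less_imp_less_base)
    qed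
    then show "\<exists>N. \<forall>m\<ge>N. \<forall>n\<ge>N. dist (Z m) (Z n) < \<epsilon>" by blast
  qed
  then obtain e where e: "Z \<longlonglongrightarrow> e" using Cauchy_convergent convergent_def by blast
  have "e \<in> W"
    unfolding W_def
  proof clarify
    fix h assume "h \<in> H"
    have "(\<lambda>n. ip (Z n) h) \<longlonglongrightarrow> ip e h"
      by (rule bounded_linear.tendsto[OF bounded_linear_ip_left e])
    moreover have "(\<lambda>n. ip (Z n) h) = (\<lambda>n. 0)"
      using Z(1) \<open>h \<in> H\<close> by (auto simp: W_def)
    ultimately show "ip e h = 0" by (simp add: LIMSEQ_const_iff)
  qed
  have "norm e = 1"
    using LIMSEQ_unique[OF tendsto_norm[OF e]] Z(2) by (simp add: LIMSEQ_const_iff)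
  have "A e = y"
    using LIMSEQ_unique[OF A.tendsto[OF e] AZ] .
  then have Ae: "norm (A e) = M" using \<open>norm y = M\<close> by simp
  \<comment> \<open>First variation at the maximizer \<open>e\<close>: moving along an orthogonal
    \<open>x\<close> changes the squared norm of the vector only to second order.\<close>
  have inner_zero: "inner (A e) (A x) = 0" if "x \<in> W" "ip x e = 0" for x
  proof (rule linear_term_zero)
    fix t :: real
    have "(norm (A (e + t *\<^sub>R x)))\<^sup>2 \<le> (M * norm (e + t *\<^sub>R x))\<^sup>2"
      using upper[OF W_add[OF \<open>e \<in> W\<close> W_scaleR[OF that(1), of t]]] by (intro power_mono) auto
    moreover have "(norm (e + t *\<^sub>R x))\<^sup>2 = 1 + t\<^sup>2 * (norm x)\<^sup>2"
      using that(2) ip_eq_zero_commute \<open>norm e = 1\<close>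
      by (subst norm_add_square_orthogonal) (auto simp: ip_scaleR_right power_mult_distrib)
    moreover have "(norm (A (e + t *\<^sub>R x)))\<^sup>2 =
        M\<^sup>2 + 2 * t * inner (A e) (A x) + t\<^sup>2 * (norm (A x))\<^sup>2"
      by (simp add: A.add A.scaleR power2_norm_eq_inner inner_add_left inner_add_right
          inner_commute flip: Ae) (simp add: power2_eq_square algebra_simps)
    ultimately show "2 * t * inner (A e) (A x) \<le> t\<^sup>2 * (M\<^sup>2 * (norm x)\<^sup>2 - (norm (A x))\<^sup>2)"
      by (simp add: power_mult_distrib algebra_simps)
  qed
  have "ip (A x) (A e) = 0" if "x \<in> W" "ip x e = 0" for x
  proof -
    \<comment> \<open>Rotating \<open>x\<close> by \<open>k\<close> makes the scalar product with
      \<open>A e\<close> real, namely the square of \<open>norm k\<close>, so the vanishing of real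
      parts is enough.\<close>
    define k where "k = ip (A e) (A x)"
    have "ip (A e) (A (scale k x)) = ip (A e) (scale (ip (A e) (A x)) (A x))"
      by (simp add: L_scale[OF AL] k_def)
    also have "\<dots> = of_real ((norm k)\<^sup>2)"
      by (simp only: ip_scale_ip_right) (metis ip_mult_commute norm_ip_commute k_def)
    finally have "inner (A e) (A (scale k x)) = (norm k)\<^sup>2"
      by (metis Re_complex_of_real Re_ip to_complex_of_real)
    then have "k = 0"
      using inner_zero[OF W_scale[OF that(1)], of k] that(2) by (simp add: ip_scale_left)
    then show ?thesis using ip_eq_zero_commute by (simp add: k_def)
  qed
  moreover have "A e \<noteq> 0" using Ae \<open>M > 0\<close> by auto
  ultimately show ?thesis
    using that[of e] \<open>e \<in> W\<close> \<open>norm e = 1\<close> upper Ae by (auto simp: W_def)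
qed

subsection \<open>Diagonal operators\<close>

definition orthonormal_seq :: "(nat \<Rightarrow> 'a) \<Rightarrow> bool" where
  "orthonormal_seq e \<longleftrightarrow> (\<forall>i j. ip (e i) (e j) = (if i = j then 1 else 0))"

lemma orthonormal_seq_ip: "orthonormal_seq e \<Longrightarrow> ip (e i) (e j) = (if i = j then 1 else 0)"
  by (simp add: orthonormal_seq_def)

lemma orthonormal_seq_norm: "orthonormal_seq e \<Longrightarrow> norm (e i) = 1"
proof -
  assume "orthonormal_seq e"
  then have "of_real ((norm (e i))\<^sup>2) = (1 :: 'k)"
    using ip_self[of "e i"] by (simp add: orthonormal_seq_ip)
  then have "(norm (e i))\<^sup>2 = 1\<^sup>2"
    by (simp only: of_real_eq_1_iff) simp
  then show "norm (e i) = 1"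
    by (simp only: power2_eq_iff_nonneg[OF norm_ge_zero zero_le_one])
qed

lemma orthonormal_seq_inj: "orthonormal_seq e \<Longrightarrow> inj e"
  by (rule injI) (metis orthonormal_seq_ip zero_neq_one)

lemma orthonormal_seq_independent:
  assumes "orthonormal_seq e"
  shows "independent (e ` I)"
proof (rule independent_orthogonal)
  show "0 \<notin> e ` I"
    using orthonormal_seq_norm[OF assms] by (metis imageE norm_zero zero_neq_one)
qed (auto simp: orthonormal_seq_ip[OF assms])

lemma norm_orthonormal_seq_sum:
  assumes "orthonormal_seq e" "finite I"
  shows "(norm (\<Sum>i\<in>I. scale (c i) (e i)))\<^sup>2 = (\<Sum>i\<in>I. (norm (c i))\<^sup>2)"
proof (subst norm_sum_square_orthogonal)
  show "ip (scale (c i) (e i)) (scale (c j) (e j)) = 0" if "i \<noteq> j" for i j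
  proof -
    have "ip (e j) (scale (c i) (e i)) = 0"
      using that by (subst ip_eq_zero_commute) (simp add: ip_scale_left orthonormal_seq_ip[OF assms(1)])
    then have "ip (scale (c j) (e j)) (scale (c i) (e i)) = 0"
      by (simp add: ip_scale_left)
    then show ?thesis
      by (subst ip_eq_zero_commute)
  qed
qed (simp_all add: assms(2) orthonormal_seq_norm[OF assms(1)])

lemma ip_orthonormal_seq_sum:
  assumes "orthonormal_seq e" "finite I" "j \<in> I"
  shows "ip (\<Sum>i\<in>I. scale (c i) (e i)) (e j) = c j"
proof -
  have "ip (\<Sum>i\<in>I. scale (c i) (e i)) (e j) = (\<Sum>i\<in>I. if i = j then c j else 0)"
    unfolding ip_sum_left ip_scale_left
    by (intro sum.cong) (auto simp: orthonormal_seq_ip[OF assms(1)])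
  then show ?thesis using assms by simp
qed

lemma bessel:
  assumes "orthonormal_seq e"
  shows "summable (\<lambda>n. (norm (ip x (e n)))\<^sup>2)"
    and "(\<Sum>i<n. (norm (ip x (e i)))\<^sup>2) \<le> (norm x)\<^sup>2"
proof -
  show *: "(\<Sum>i<n. (norm (ip x (e i)))\<^sup>2) \<le> (norm x)\<^sup>2" for n
  proof -
    define p where "p = (\<Sum>i<n. scale (ip x (e i)) (e i))"
    have "ip (x - p) (e i) = 0" if "i < n" for i
      using that by (simp add: p_def ip_diff_left ip_orthonormal_seq_sum[OF assms])
    then have zero: "ip (e i) (x - p) = 0" if "i < n" for i
      using that ip_eq_zero_commute by blast
    have "ip p (x - p) = (\<Sum>i<n. ip x (e i) * ip (e i) (x - p))"
      by (subst (1) p_def) (simp only: ip_sum_left ip_scale_left)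
    also have "\<dots> = 0" using zero by (intro sum.neutral) auto
    finally have "ip p (x - p) = 0" .
    then have "(norm (p + (x - p)))\<^sup>2 = (norm p)\<^sup>2 + (norm (x - p))\<^sup>2"
      by (rule norm_add_square_orthogonal)
    then show ?thesis
      by (simp add: p_def norm_orthonormal_seq_sum[OF assms])
  qed
  show "summable (\<lambda>n. (norm (ip x (e n)))\<^sup>2)"
    by (rule summableI_nonneg_bounded[OF _ *]) simp
qed

text \<open>The operator that takes \<open>e n\<close> to \<open>a n *\<^sub>R f n\<close> and kills
  what is orthogonal to all \<open>e n\<close>. With constant weight \<open>1\<close> and
  \<open>f = e\<close> it is the orthogonal projection onto the closed span of
  \<open>e\<close>.\<close>

definition diag :: "(nat \<Rightarrow> real) \<Rightarrow> (nat \<Rightarrow> 'a) \<Rightarrow> (nat \<Rightarrow> 'a) \<Rightarrow> 'a \<Rightarrow> 'a" where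
  "diag a e f x = (\<Sum>n. scale (of_real (a n) * ip x (e n)) (f n))"

context
  fixes a :: "nat \<Rightarrow> real" and e f :: "nat \<Rightarrow> 'a" and K :: real
  assumes e: "orthonormal_seq e" and f: "orthonormal_seq f" and a: "\<And>n. \<bar>a n\<bar> \<le> K"
begin

lemma norm_diag_segment_le:
  assumes "finite I"
  shows "(norm (\<Sum>i\<in>I. scale (of_real (a i) * ip x (e i)) (f i)))\<^sup>2 \<le>
    K\<^sup>2 * (\<Sum>i\<in>I. (norm (ip x (e i)))\<^sup>2)"
  unfolding norm_orthonormal_seq_sum[OF f assms] sum_distrib_left
proof (rule sum_mono)
  fix i
  have "(a i)\<^sup>2 \<le> K\<^sup>2" using a[of i] by (rule sqrt_le_D[OF order_trans[OF eq_refl[OF real_sqrt_abs]]])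
  then show "(norm (of_real (a i) * ip x (e i)))\<^sup>2 \<le> K\<^sup>2 * (norm (ip x (e i)))\<^sup>2"
    by (simp add: norm_mult power_mult_distrib mult_right_mono)
qed

text \<open>Differences of partial sums are bounded by those of the convergent Bessel series, so
  completeness applies.\<close>

lemma diag_sums: "(\<lambda>n. scale (of_real (a n) * ip x (e n)) (f n)) sums diag a e f x"
proof -
  define S where "S n = (\<Sum>i<n. scale (of_real (a i) * ip x (e i)) (f i))" for n
  define R where "R n = (\<Sum>i<n. (norm (ip x (e i)))\<^sup>2)" for n
  have "K \<ge> 0" using a[of 0] by linarith
  have step: "(norm (S n - S m))\<^sup>2 \<le> K\<^sup>2 * \<bar>R n - R m\<bar>" if "m \<le> n" for m n
  proof -
    have "S n - S m = (\<Sum>i\<in>{m..<n}. scale (of_real (a i) * ip x (e i)) (f i))"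
      "R n - R m = (\<Sum>i\<in>{m..<n}. (norm (ip x (e i)))\<^sup>2)"
      unfolding S_def R_def using that by (simp_all add: sum_diff_nat_ivl lessThan_atLeast0)
    then show ?thesis
      using norm_diag_segment_le[of "{m..<n}" x] by (simp add: sum_nonneg)
  qed
  have "Cauchy R"
    using bessel(1)[OF e, of x] unfolding R_def[abs_def] summable_iff_convergent
    by (rule convergent_Cauchy)
  have "Cauchy S"
  proof (rule metric_CauchyI)
    fix \<epsilon> :: real assume "\<epsilon> > 0"
    \<comment> \<open>The bound \<open>K\<close> may be zero, hence \<open>K + 1\<close> in the
      denominator.\<close>
    then have "(\<epsilon> / (K + 1))\<^sup>2 > 0" using \<open>K \<ge> 0\<close> by simp
    then obtain N where N: "\<And>m n. m \<ge> N \<Longrightarrow> n \<ge> N \<Longrightarrow> dist (R m) (R n) < (\<epsilon> / (K + 1))\<^sup>2"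
      using \<open>Cauchy R\<close> unfolding Cauchy_def by metis
    have less: "dist (S n) (S m) < \<epsilon>" if "m \<ge> N" "n \<ge> N" "m \<le> n" for m n
    proof -
      have "(norm (S n - S m))\<^sup>2 \<le> K\<^sup>2 * \<bar>R n - R m\<bar>" by (rule step) fact
      also have "\<dots> \<le> (K + 1)\<^sup>2 * \<bar>R n - R m\<bar>"
        using \<open>K \<ge> 0\<close> by (intro mult_right_mono power_mono) auto
      also have "\<dots> < (K + 1)\<^sup>2 * (\<epsilon> / (K + 1))\<^sup>2"
        using N[OF that(2,1)] \<open>K \<ge> 0\<close> by (intro mult_strict_left_mono) (auto simp: dist_real_def)
      also have "\<dots> = \<epsilon>\<^sup>2" using \<open>K \<ge> 0\<close> by (simp add: power_divide)
      finally show ?thesis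
        using \<open>\<epsilon> > 0\<close> by (simp add: dist_norm power_less_imp_less_base)
    qed
    then have "dist (S m) (S n) < \<epsilon>" if "m \<ge> N" "n \<ge> N" for m n
      using that by (metis dist_commute nat_le_linear)
    then show "\<exists>N. \<forall>m\<ge>N. \<forall>n\<ge>N. dist (S m) (S n) < \<epsilon>" by blast
  qed
  then have "convergent S" by (rule Cauchy_convergent)
  then have "summable (\<lambda>n. scale (of_real (a n) * ip x (e n)) (f n))"
    unfolding S_def[abs_def] by (simp add: summable_iff_convergent)
  then show ?thesis unfolding diag_def by (rule summable_sums)
qed

lemma norm_diag_le: "norm (diag a e f x) \<le> K * norm x"
proof -
  have "K \<ge> 0" using a[of 0] by linarith
  show ?thesis
  proof (rule LIMSEQ_le_const2[OF tendsto_norm[OF diag_sums[unfolded sums_def]]], intro exI allI impI)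
    fix n
    have "(norm (\<Sum>i<n. scale (of_real (a i) * ip x (e i)) (f i)))\<^sup>2 \<le>
        K\<^sup>2 * (\<Sum>i<n. (norm (ip x (e i)))\<^sup>2)"
      by (rule norm_diag_segment_le) simp
    also have "\<dots> \<le> K\<^sup>2 * (norm x)\<^sup>2"
      by (intro mult_left_mono bessel e) simp
    finally show "norm (\<Sum>i<n. scale (of_real (a i) * ip x (e i)) (f i)) \<le> K * norm x"
      using \<open>K \<ge> 0\<close> by - (rule power2_le_imp_le, simp_all add: power_mult_distrib)
  qed
qed

lemma L_diag: "diag a e f \<in> L"
proof -
  have add: "diag a e f (x + y) = diag a e f x + diag a e f y" for x y
    by (rule sums_unique2[OF diag_sums])
      (use sums_add[OF diag_sums[of x] diag_sums[of y]] in
        \<open>simp add: ip_add_left distrib_left scale_left_distrib\<close>)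
  have scale: "diag a e f (scale c x) = scale c (diag a e f x)" for c x
  proof -
    have "scale c (r *\<^sub>R y) = r *\<^sub>R scale c y" for r y
      by (metis scale_left_commute scale_of_real)
    then have "bounded_linear (scale c)"
      by (intro bounded_linear_intro[where K = "norm c"])
        (simp_all add: scale_right_distrib mult.commute)
    from bounded_linear.sums[OF this diag_sums[of x]] show ?thesis
      by (intro sums_unique2[OF diag_sums]) (simp only: ip_scale_left mult.left_commute scale_scale)
  qed
  have "bounded_linear (diag a e f)"
  proof (rule bounded_linear_intro)
    show "diag a e f (x + y) = diag a e f x + diag a e f y" for x y by (rule add)
    show "diag a e f (r *\<^sub>R x) = r *\<^sub>R diag a e f x" for r x
      using scale[of "of_real r"] by (simp only: scale_of_real)
    show "norm (diag a e f x) \<le> norm x * K" for x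
      using norm_diag_le[of x] by (simp only: mult.commute)
  qed
  then show ?thesis
    by (simp add: L_def scale)
qed

lemma diag_orthogonal:
  assumes "\<And>n. ip (f n) y = 0"
  shows "ip (diag a e f x) y = 0"
proof -
  have "(\<lambda>n. ip (scale (of_real (a n) * ip x (e n)) (f n)) y) sums ip (diag a e f x) y"
    by (rule bounded_linear.sums[OF bounded_linear_ip_left diag_sums])
  then have "(\<lambda>n. 0) sums ip (diag a e f x) y"
    by (simp add: ip_scale_left assms)
  then show ?thesis by (rule sums_unique2[OF _ sums_zero])
qed

lemma ip_diag: "ip (diag a e f x) (f n) = of_real (a n) * ip x (e n)"
proof (rule sums_unique2[OF bounded_linear.sums[OF bounded_linear_ip_left diag_sums]])
  have "(\<lambda>m. ip (scale (of_real (a m) * ip x (e m)) (f m)) (f n)) =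
      (\<lambda>m. if m = n then of_real (a m) * ip x (e m) else 0)"
    by (auto simp: ip_scale_left orthonormal_seq_ip[OF f])
  then show "(\<lambda>m. ip (scale (of_real (a m) * ip x (e m)) (f m)) (f n)) sums
      (of_real (a n) * ip x (e n))"
    using sums_single[of n "\<lambda>m. of_real (a m) * ip x (e m)"] by simp
qed

lemma diag_comp:
  shows "diag b f g (diag a e f x) = diag (\<lambda>n. b n * a n) e g x"
  unfolding diag_def[of b] diag_def[of "\<lambda>n. b n * a n"] ip_diag by (simp add: mult.assoc)

end

text \<open>Both sides are the sum of the same scalar series.\<close>

lemma ip_diag_adjoint:
  assumes e: "orthonormal_seq e" and f: "orthonormal_seq f" and a: "\<And>n. \<bar>a n\<bar> \<le> K"
  shows "ip (diag a e f x) y = ip x (diag a f e y)"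
proof (rule sums_unique2)
  show "(\<lambda>n. of_real (a n) * ip x (e n) * ip (f n) y) sums ip (diag a e f x) y"
    using bounded_linear.sums[OF bounded_linear_ip_left diag_sums[OF e f a]]
    by (simp add: ip_scale_left)
  have "ip x (scale (of_real (a n) * ip y (f n)) (e n)) =
      of_real (a n) * ip x (e n) * ip (f n) y" for n
    unfolding scale_scale[symmetric] scale_of_real ip_scaleR_right ip_scale_ip_right
    by simp
  moreover have "(\<lambda>n. ip x (scale (of_real (a n) * ip y (f n)) (e n))) sums ip x (diag a f e y)"
    by (rule bounded_linear.sums[OF bounded_linear_ip_right diag_sums[OF f e a]])
  ultimately show "(\<lambda>n. of_real (a n) * ip x (e n) * ip (f n) y) sums ip x (diag a f e y)"
    by simp
qed

lemma ip_residual: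
  assumes "orthonormal_seq e"
  shows "ip (x - diag (\<lambda>_. 1) e e x) (e n) = 0"
  using ip_diag[OF assms assms, of "\<lambda>_. 1" 1] by (simp add: ip_diff_left)

text \<open>Subtracting the projection onto the closed span of \<open>e\<close> leaves a vector that
  \<open>T\<close> kills, and on the projection \<open>T\<close> acts term by term. This recognizes
  \<open>A\<close>, its modulus and the composite of \<open>A\<close> with a diagonal
  operator.\<close>

lemma L_eq_diag:
  assumes T: "T \<in> L" and e: "orthonormal_seq e" and f: "orthonormal_seq f" and a: "\<And>n. \<bar>a n\<bar> \<le> K"
    and Te: "\<And>n. T (e n) = a n *\<^sub>R f n" and zero: "\<And>x. (\<And>n. ip x (e n) = 0) \<Longrightarrow> T x = 0"
  shows "T = diag a e f"
proof
  fix x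
  have "T (x - diag (\<lambda>_. 1) e e x) = 0"
    by (rule zero) (rule ip_residual[OF e])
  then have "T x = T (diag (\<lambda>_. 1) e e x)"
    by (simp add: L_map_diff[OF T])
  also have "\<dots> = diag a e f x"
  proof (rule sums_unique2[OF _ diag_sums[OF e f a]])
    have "T (scale (ip x (e n)) (e n)) = scale (of_real (a n) * ip x (e n)) (f n)" for n
      by (simp add: L_scale[OF T] Te mult.commute flip: scale_of_real)
    then show "(\<lambda>n. scale (of_real (a n) * ip x (e n)) (f n)) sums T (diag (\<lambda>_. 1) e e x)"
      using bounded_linear.sums[OF L_bounded_linear[OF T] diag_sums[OF e e, of "\<lambda>_. 1" 1 x]]
      by simp
  qed
  finally show "T x = diag a e f x" .
qed

section \<open>Successive extremal vectors on an orthogonal complement\<close>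

text \<open>Dependent choice: \<open>f n\<close> maximizes \<open>norm (A x)\<close> on the unit
  sphere of the orthogonal complement of \<open>H\<close> and its predecessors, and infinite rank
  keeps the process going. The result is the sequence of right singular vectors of the restriction
  of \<open>A\<close> to the complement of \<open>H\<close>.\<close>

lemma singular_vectors:
  assumes A: "compact_operator A" and rank: "\<not> finite_dimensional (range A)" and "finite H"
  obtains f where "orthonormal_seq f" "\<And>n h. h \<in> H \<Longrightarrow> ip (f n) h = 0" "\<And>n. A (f n) \<noteq> 0"
    "\<And>n x. \<forall>h\<in>H. ip x h = 0 \<Longrightarrow> \<forall>i<n. ip x (f i) = 0 \<Longrightarrow>
      norm (A x) \<le> norm (A (f n)) * norm x"
    "\<And>n x. \<forall>h\<in>H. ip x h = 0 \<Longrightarrow> \<forall>i\<le>n. ip x (f i) = 0 \<Longrightarrow>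
      ip (A x) (A (f n)) = 0"
proof -
  have AL: "A \<in> L" using A by (simp add: compact_operator_def)
  define P where "P f n r \<longleftrightarrow> (\<forall>h\<in>H \<union> f ` {..<n}. ip r h = 0) \<and> norm r = 1 \<and> A r \<noteq> 0 \<and>
    (\<forall>x. (\<forall>h\<in>H \<union> f ` {..<n}. ip x h = 0) \<longrightarrow>
      norm (A x) \<le> norm (A r) * norm x \<and> (ip x r = 0 \<longrightarrow> ip (A x) (A r) = 0))"
    for f :: "nat \<Rightarrow> 'a" and n r
  have "\<exists>f. \<forall>n. P f n (f n)"
  proof (rule dependent_wellorder_choice)
    show "P f n r = P g n r" if "\<And>m. m < n \<Longrightarrow> f m = g m" for f g n r
    proof -
      have "f ` {..<n} = g ` {..<n}" using that by (intro image_cong) auto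
      then show ?thesis unfolding P_def by simp
    qed
    show "\<exists>r. P f n r" for n f
    proof -
      have "\<exists>w. (\<forall>h\<in>H \<union> f ` {..<n}. ip w h = 0) \<and> A w \<noteq> 0"
      proof (rule ccontr)
        assume "\<not> ?thesis"
        then have "finite_dimensional (range A)"
          using \<open>finite H\<close>
          by (intro finite_rank_if_zero_on_orthogonal[OF AL, of "H \<union> f ` {..<n}"]) auto
        with rank show False ..
      qed
      then obtain w where w: "\<And>h. h \<in> H \<union> f ` {..<n} \<Longrightarrow> ip w h = 0" "A w \<noteq> 0" by blast
      show ?thesis
      proof (rule norm_attained_on_orthogonal[OF A w])
        fix r assume r: "\<And>h. h \<in> H \<union> f ` {..<n} \<Longrightarrow> ip r h = 0" "norm r = 1" "A r \<noteq> 0"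
          "\<And>x. (\<And>h. h \<in> H \<union> f ` {..<n} \<Longrightarrow> ip x h = 0) \<Longrightarrow> norm (A x) \<le> norm (A r) * norm x"
          "\<And>x. (\<And>h. h \<in> H \<union> f ` {..<n} \<Longrightarrow> ip x h = 0) \<Longrightarrow> ip x r = 0 \<Longrightarrow> ip (A x) (A r) = 0"
        have "P f n r"
          unfolding P_def by (intro conjI ballI allI impI r) blast+
        then show ?thesis ..
      qed
    qed
  qed
  then obtain f where f: "\<And>n. P f n (f n)" by blast
  have less: "ip (f n) (f i) = 0" if "i < n" for i n
    using f[of n] that by (auto simp: P_def)
  have "orthonormal_seq f"
    unfolding orthonormal_seq_def
  proof (intro allI)
    fix i j
    have "ip (f i) (f i) = 1" using f[of i] by (simp add: P_def ip_self)
    moreover have "ip (f i) (f j) = 0" if "i \<noteq> j"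
      using less[of i j] less[of j i] that ip_eq_zero_commute by (cases "i < j") auto
    ultimately show "ip (f i) (f j) = (if i = j then 1 else 0)" by (cases "i = j") auto
  qed
  moreover have "ip (f n) h = 0" if "h \<in> H" for n h
    using f[of n] that by (auto simp: P_def)
  moreover have "A (f n) \<noteq> 0" for n using f[of n] by (auto simp: P_def)
  moreover have "norm (A x) \<le> norm (A (f n)) * norm x"
    if "\<forall>h\<in>H. ip x h = 0" "\<forall>i<n. ip x (f i) = 0" for n x
  proof -
    have "\<forall>h\<in>H \<union> f ` {..<n}. ip x h = 0" using that by auto
    then show ?thesis using f[of n] unfolding P_def by blast
  qed
  moreover have "ip (A x) (A (f n)) = 0"
    if "\<forall>h\<in>H. ip x h = 0" "\<forall>i\<le>n. ip x (f i) = 0" for n x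
  proof -
    have "\<forall>h\<in>H \<union> f ` {..<n}. ip x h = 0" "ip x (f n) = 0"
      using that by auto
    then show ?thesis using f[of n] unfolding P_def by blast
  qed
  ultimately show ?thesis by (rule that)
qed

lemma diag_basis:
  assumes e: "orthonormal_seq e" and f: "orthonormal_seq f" and a: "\<And>n. \<bar>a n\<bar> \<le> K"
  shows "diag a e f (e n) = a n *\<^sub>R f n"
proof (rule sums_unique2[OF diag_sums[OF e f a]])
  have "(\<lambda>m. scale (of_real (a m) * ip (e n) (e m)) (f m)) = (\<lambda>m. if m = n then a m *\<^sub>R f m else 0)"
    by (auto simp: orthonormal_seq_ip[OF e] scale_of_real)
  then show "(\<lambda>m. scale (of_real (a m) * ip (e n) (e m)) (f m)) sums (a n *\<^sub>R f n)"
    using sums_single[of n "\<lambda>m. a m *\<^sub>R f m"] by simp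
qed

lemma ip_right_eqI: "(\<And>x. ip x y = ip x z) \<Longrightarrow> y = z"
  using ip_self_eq_zero[of "y - z"] by (simp only: ip_diff_right) simp

section \<open>Membership in the weak operator closure\<close>

lemma topspace_weak_operator_topology: "topspace weak_operator_topology = L"
  by (simp add: weak_operator_topology_def topspace_pullback_topology)

text \<open>A basic open set of the product topology constrains finitely many coordinates
  \<open>(x, y)\<close>. Exact agreement there suffices, so no estimates are needed.\<close>

lemma in_WE_I:
  assumes T: "T \<in> L"
    and approx: "\<And>F G. finite F \<Longrightarrow> finite G \<Longrightarrow>
      \<exists>S\<in>E A. \<forall>x\<in>F. \<forall>y\<in>G. ip (S x) y = ip (T x) y"
  shows "T \<in> WE A"
  unfolding WE_def in_closure_of topspace_weak_operator_topology
proof (intro conjI allI impI T)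
  define \<phi> where "\<phi> = (\<lambda>(T :: 'a \<Rightarrow> 'a) (x, y). ip (T x) y)"
  fix V assume "T \<in> V \<and> openin weak_operator_topology V"
  then obtain U where U: "open U" "V = \<phi> -` U \<inter> L" "\<phi> T \<in> U"
    by (auto simp: weak_operator_topology_def openin_pullback_topology \<phi>_def)
  have "openin (product_topology (\<lambda>_. euclidean) UNIV) U"
    using U(1) by (simp add: euclidean_product_topology)
  from product_topology_open_contains_basis[OF this U(3)]
  obtain X where X: "\<phi> T \<in> (\<Pi>\<^sub>E i\<in>UNIV. X i)" "finite {i. X i \<noteq> UNIV}" "(\<Pi>\<^sub>E i\<in>UNIV. X i) \<subseteq> U"
    by auto
  \<comment> \<open>The grid of first and second components contains all the constrained
    pairs.\<close>
  obtain S where S: "S \<in> E A"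
    "\<forall>x\<in>fst ` {i. X i \<noteq> UNIV}. \<forall>y\<in>snd ` {i. X i \<noteq> UNIV}. ip (S x) y = ip (T x) y"
    using approx[of "fst ` {i. X i \<noteq> UNIV}" "snd ` {i. X i \<noteq> UNIV}"] X(2) by auto
  have "\<phi> S i \<in> X i" for i
  proof (cases "X i = UNIV")
    case False
    then have "\<phi> S i = \<phi> T i" using S(2) by (cases i) (force simp: \<phi>_def)
    then show ?thesis using X(1) by auto
  qed simp
  then have "\<phi> S \<in> U" using X(3) by auto
  moreover have "S \<in> L" using S(1) by (simp add: E_def)
  ultimately show "\<exists>S. S \<in> E A \<and> S \<in> V" using S(1) U(2) by auto
qed

lemma WE_subset_L: "WE A \<subseteq> L"
  using closure_of_subset_topspace by (simp add: WE_def flip: topspace_weak_operator_topology)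

text \<open>Nonvanishing of a single matrix coefficient is an open condition, so it holds on a
  neighbourhood of \<open>T\<close>, which meets \<open>E A\<close>.\<close>

lemma in_WE_D:
  assumes "T \<in> WE A" "ip (T x) y \<noteq> 0"
  obtains S where "S \<in> E A" "ip (S x) y \<noteq> 0"
proof -
  define \<phi> where "\<phi> = (\<lambda>(T :: 'a \<Rightarrow> 'a) (x, y). ip (T x) y)"
  define U where "U = {g :: 'a \<times> 'a \<Rightarrow> 'k. g (x, y) \<noteq> 0}"
  have "open U"
    unfolding U_def
    by (rule open_Collect_neq[OF continuous_on_product_coordinates continuous_on_const])
  then have "openin weak_operator_topology (\<phi> -` U \<inter> L)"
    by (auto simp: weak_operator_topology_def openin_pullback_topology \<phi>_def)
  moreover have "T \<in> \<phi> -` U \<inter> L"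
    using assms WE_subset_L by (auto simp: \<phi>_def U_def)
  ultimately obtain S where "S \<in> E A" "S \<in> \<phi> -` U"
    using assms(1) unfolding WE_def in_closure_of by (metis IntD1)
  then show ?thesis using that by (auto simp: \<phi>_def U_def)
qed

section \<open>Norms and finite expansions in orthonormal sequences\<close>

text \<open>The norm of each partial sum depends on the coefficients alone.\<close>

lemma norm_diag_eq:
  assumes e: "orthonormal_seq e" and f: "orthonormal_seq f" and g: "orthonormal_seq g"
    and a: "\<And>n. \<bar>a n\<bar> \<le> K"
  shows "norm (diag a e f x) = norm (diag a e g x)"
proof (rule LIMSEQ_unique)
  show "(\<lambda>n. norm (\<Sum>i<n. scale (of_real (a i) * ip x (e i)) (f i))) \<longlonglongrightarrow> norm (diag a e f x)"
    by (rule tendsto_norm[OF diag_sums[OF e f a, unfolded sums_def]])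
  have "norm (\<Sum>i<n. scale (of_real (a i) * ip x (e i)) (f i)) =
      norm (\<Sum>i<n. scale (of_real (a i) * ip x (e i)) (g i))" for n
    using norm_orthonormal_seq_sum[OF f, of "{..<n}"] norm_orthonormal_seq_sum[OF g, of "{..<n}"]
    by - (rule power2_eq_imp_eq, simp_all)
  with tendsto_norm[OF diag_sums[OF e g a, unfolded sums_def]]
  show "(\<lambda>n. norm (\<Sum>i<n. scale (of_real (a i) * ip x (e i)) (f i))) \<longlonglongrightarrow> norm (diag a e g x)"
    by simp
qed

lemma expand_orthonormal_seq:
  assumes e: "orthonormal_seq e" and "finite I" "x \<in> span (e ` I)"
  shows "x = (\<Sum>i\<in>I. scale (ip x (e i)) (e i))"
proof -
  define P where "P x = (\<Sum>i\<in>I. scale (ip x (e i)) (e i))" for x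
  have PL: "P \<in> L" unfolding P_def[abs_def] by (intro L_sum L_rank_one L_id)
  have Pe: "P (e j) = e j" if "j \<in> I" for j
  proof -
    have "P (e j) = (\<Sum>i\<in>I. if i = j then e j else 0)"
      unfolding P_def by (intro sum.cong) (auto simp: orthonormal_seq_ip[OF e])
    then show ?thesis using that \<open>finite I\<close> by simp
  qed
  have "P x = x"
    using assms(3) by (induction rule: span_induct_alt)
      (auto simp: Pe L_map_zero[OF PL] L_map_add[OF PL] L_scale[OF PL])
  then show ?thesis by (simp add: P_def)
qed

subsection \<open>Singular values\<close>

text \<open>
  The fourth to last clauses say that \<open>s\<close> decreases to \<open>0\<close>, that \<open>A\<^sup>*A (e n) = (s n)\<^sup>2 e n\<close>, stated
  without the adjoint, and that each \<open>e n\<close> is extremal on the complement of its predecessors.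
\<close>

definition singular_system :: "('a \<Rightarrow> 'a) \<Rightarrow> (nat \<Rightarrow> 'a) \<Rightarrow> (nat \<Rightarrow> real) \<Rightarrow> bool" where
  "singular_system A e s \<longleftrightarrow> A \<in> L \<and> orthonormal_seq e \<and> (\<forall>n. s n > 0) \<and> decseq s \<and> s \<longlonglongrightarrow> 0 \<and>
    (\<forall>n x. ip (A x) (A (e n)) = of_real ((s n)\<^sup>2) * ip x (e n)) \<and>
    (\<forall>n x. (\<forall>i<n. ip x (e i) = 0) \<longrightarrow> norm (A x) \<le> s n * norm x)"

text \<open>The extremal vectors for empty \<open>H\<close> serve as \<open>e\<close>, with
  \<open>s n = norm (A (e n))\<close>. Their images are orthogonal, which yields the eigenvector
  relation; compactness yields the limit.\<close>

lemma exists_singular_system: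
  assumes A: "compact_operator A" and rank: "\<not> finite_dimensional (range A)"
  obtains e s where "singular_system A e s"
proof -
  have AL: "A \<in> L" and compact: "compact (closure (A ` cball 0 1))"
    using A by (auto simp: compact_operator_def)
  obtain e where e: "orthonormal_seq e" "\<And>n. A (e n) \<noteq> 0"
    and max: "\<And>n x. \<forall>i<n. ip x (e i) = 0 \<Longrightarrow> norm (A x) \<le> norm (A (e n)) * norm x"
    and orth: "\<And>n x. \<forall>i\<le>n. ip x (e i) = 0 \<Longrightarrow> ip (A x) (A (e n)) = 0"
    using singular_vectors[OF A rank finite.emptyI] by auto
  define s where "s n = norm (A (e n))" for n
  have s_pos: "s n > 0" for n using e(2) by (simp add: s_def)
  have less: "ip (A (e n)) (A (e m)) = 0" if "m < n" for m n
    using that by (intro orth) (simp add: orthonormal_seq_ip[OF e(1)])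
  have Ae: "ip (A (e m)) (A (e n)) = (if m = n then of_real ((s n)\<^sup>2) else 0)" for m n
    using less[of m n] less[of n m] ip_eq_zero_commute[of "A (e m)" "A (e n)"]
    by (cases m n rule: linorder_cases) (auto simp: ip_self s_def)
  have coeff: "ip (A x) (A (e n)) = of_real ((s n)\<^sup>2) * ip x (e n)" for n x
  proof -
    \<comment> \<open>Without its first \<open>n + 1\<close> components, \<open>x\<close> satisfies
      the hypothesis of \<open>orth\<close>.\<close>
    define p where "p = (\<Sum>i\<le>n. scale (ip x (e i)) (e i))"
    have "ip (A (x - p)) (A (e n)) = 0"
      by (rule orth) (simp add: p_def ip_diff_left ip_orthonormal_seq_sum[OF e(1)])
    then have "ip (A x) (A (e n)) = (\<Sum>i\<le>n. ip x (e i) * ip (A (e i)) (A (e n)))"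
      by (simp add: L_map_diff[OF AL] ip_diff_left p_def L_map_sum[OF AL] ip_sum_left ip_scale_left)
    then show ?thesis
      by (simp add: Ae if_distrib[of "\<lambda>c. _ * c"] cong: if_cong)
  qed
  have "decseq s"
  proof (rule decseq_SucI)
    fix n
    have "norm (A (e (Suc n))) \<le> norm (A (e n)) * norm (e (Suc n))"
      by (rule max) (simp add: orthonormal_seq_ip[OF e(1)])
    then show "s (Suc n) \<le> s n"
      by (simp add: s_def orthonormal_seq_norm[OF e(1)])
  qed
  have "s \<longlonglongrightarrow> 0"
  proof -
    obtain l where l: "s \<longlonglongrightarrow> l"
      using decseq_convergent[OF \<open>decseq s\<close>, of 0] s_pos less_imp_le by metis
    have "\<forall>n. A (e n) \<in> closure (A ` cball 0 1)"
      using orthonormal_seq_norm[OF e(1)] closure_subset[of "A ` cball 0 1"]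
      by (force simp: dist_norm)
    with compact obtain y r where r: "strict_mono r" "((\<lambda>n. A (e n)) \<circ> r) \<longlonglongrightarrow> y"
      unfolding compact_def by metis
    \<comment> \<open>Orthogonal images \<open>A (e (r n))\<close> and
      \<open>A (e (r (Suc n)))\<close> are at least \<open>s (r n)\<close> apart, so a convergent
      subsequence of images forces \<open>s\<close> to tend to \<open>0\<close> along it, and
      monotonicity gives the rest.\<close>
    have "(\<lambda>n. norm (A (e (r n)) - A (e (r (Suc n))))) \<longlonglongrightarrow> norm (y - y)"
      using r(2) LIMSEQ_Suc[OF r(2)] by (intro tendsto_intros) (simp_all add: o_def)
    then have lim: "(\<lambda>n. norm (A (e (r n)) - A (e (r (Suc n))))) \<longlonglongrightarrow> 0" by simp
    have "s (r n) \<le> norm (A (e (r n)) - A (e (r (Suc n))))" for n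
    proof (rule power2_le_imp_le)
      have "r n \<noteq> r (Suc n)" using strict_monoD[OF r(1), of n "Suc n"] by simp
      then have "(norm (A (e (r n)) + - A (e (r (Suc n)))))\<^sup>2 =
          (s (r n))\<^sup>2 + (s (r (Suc n)))\<^sup>2"
        by (subst norm_add_square_orthogonal) (simp_all add: Ae s_def)
      then show "(s (r n))\<^sup>2 \<le> (norm (A (e (r n)) - A (e (r (Suc n)))))\<^sup>2" by simp
    qed simp
    then have "(\<lambda>n. s (r n)) \<longlonglongrightarrow> 0"
      using s_pos by (intro tendsto_sandwich[OF _ _ tendsto_const lim]) (auto simp: less_imp_le)
    then have "l = 0"
      using LIMSEQ_subseq_LIMSEQ[OF l r(1)] LIMSEQ_unique by (force simp: o_def)
    with l show ?thesis by simp
  qed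
  then have "singular_system A e s"
    unfolding singular_system_def
    using AL e(1) s_pos \<open>decseq s\<close> coeff max by (auto simp: s_def)
  then show ?thesis by (rule that)
qed

context
  fixes A e s
  assumes system: "singular_system A e s"
begin

lemma system_L: "A \<in> L"
  and system_orthonormal: "orthonormal_seq e"
  and system_pos: "s n > 0"
  and system_decseq: "decseq s"
  and system_tendsto: "s \<longlonglongrightarrow> 0"
  and system_coeff: "ip (A x) (A (e n)) = of_real ((s n)\<^sup>2) * ip x (e n)"
  and system_max: "(\<And>i. i < n \<Longrightarrow> ip x (e i) = 0) \<Longrightarrow> norm (A x) \<le> s n * norm x"
  using system unfolding singular_system_def by blast+

lemma system_abs_le: "\<bar>s n\<bar> \<le> s 0"
  using decseqD[OF system_decseq, of 0 n] system_pos[of n] by simp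

lemma system_norm: "norm (A (e n)) = s n"
proof -
  have "of_real ((norm (A (e n)))\<^sup>2) = (of_real ((s n)\<^sup>2) :: 'k)"
    using system_coeff[of "e n" n]
    unfolding ip_self[symmetric] by (simp add: orthonormal_seq_ip[OF system_orthonormal])
  then have "(norm (A (e n)))\<^sup>2 = (s n)\<^sup>2" by (simp only: of_real_eq_iff)
  then show ?thesis using less_imp_le[OF system_pos] by (simp add: power2_eq_iff_nonneg)
qed

text \<open>A vector orthogonal to all \<open>e n\<close> is subject to every bound
  \<open>s n * norm x\<close>, and \<open>s\<close> tends to \<open>0\<close>.\<close>

lemma system_ker_iff: "A x = 0 \<longleftrightarrow> (\<forall>n. ip x (e n) = 0)"
proof
  assume "A x = 0"
  then show "\<forall>n. ip x (e n) = 0"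
    using system_coeff[of x] system_pos by (metis ip_zero_left less_numeral_extra(3)
        mult_eq_0_iff of_real_eq_0_iff zero_less_power)
next
  assume zero: "\<forall>n. ip x (e n) = 0"
  have "(\<lambda>n. s n * norm x) \<longlonglongrightarrow> 0 * norm x"
    by (intro tendsto_intros system_tendsto)
  then have "norm (A x) \<le> 0 * norm x"
    by (rule LIMSEQ_le_const) (use zero in \<open>auto intro!: system_max\<close>)
  then show "A x = 0" by simp
qed

section \<open>Singular value decomposition and identification of the s-numbers\<close>

text \<open>The left singular vectors of \<open>A\<close>; \<open>A = diag s e left_vectors\<close>
  is its singular value decomposition.\<close>

definition left_vectors :: "nat \<Rightarrow> 'a" where
  "left_vectors n = (1 / s n) *\<^sub>R A (e n)"

lemma left_vectors_orthonormal: "orthonormal_seq left_vectors"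
  unfolding orthonormal_seq_def left_vectors_def ip_scaleR_left ip_scaleR_right system_coeff
  using system_pos
  by (auto simp: orthonormal_seq_ip[OF system_orthonormal] power2_eq_square less_imp_neq[symmetric])

lemma system_eq_diag: "A = diag s e left_vectors"
proof (rule L_eq_diag[OF system_L system_orthonormal left_vectors_orthonormal system_abs_le])
  show "A (e n) = s n *\<^sub>R left_vectors n" for n
    using system_pos[of n] by (simp add: left_vectors_def)
qed (simp add: system_ker_iff)

text \<open>Exchanging the two orthonormal sequences of a diagonal operator gives the adjoint, and
  an adjoint is determined by its scalar products.\<close>

lemma adj_eq_diag: "adj A = diag s left_vectors e"
proof -
  have adjoint: "ip (A x) y = ip x (diag s left_vectors e y)" for x y
    by (subst system_eq_diag)
      (rule ip_diag_adjoint[OF system_orthonormal left_vectors_orthonormal system_abs_le])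
  show ?thesis
    unfolding adj_def
  proof (rule the_equality)
    show "\<forall>x y. ip (A x) y = ip x (diag s left_vectors e y)" using adjoint by simp
    show "B = diag s left_vectors e" if "\<forall>x y. ip (A x) y = ip x (B y)" for B
      using that adjoint by (intro ext ip_right_eqI) metis
  qed
qed

lemma adj_comp_eq_diag: "adj A \<circ> A = diag (\<lambda>n. s n * s n) e e"
proof
  fix x
  have "(adj A \<circ> A) x = diag s left_vectors e (diag s e left_vectors x)"
    using adj_eq_diag system_eq_diag by (metis comp_apply)
  then show "(adj A \<circ> A) x = diag (\<lambda>n. s n * s n) e e x"
    using diag_comp[OF system_orthonormal left_vectors_orthonormal system_abs_le] by simp
qed

text \<open>Uniqueness is elementary here: a positive \<open>Q\<close> with the same square must act
  on each \<open>e n\<close> as \<open>s n\<close>, and it vanishes where its square does since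
  \<open>ip (Q x) (Q x) = ip (Q (Q x)) x\<close>.\<close>

lemma sqrt_eq_diag: "sqrt_operator (adj A \<circ> A) = diag s e e"
  unfolding sqrt_operator_def
proof (rule the_equality)
  note e = system_orthonormal
  have square: "diag s e e \<circ> diag s e e = adj A \<circ> A"
    unfolding adj_comp_eq_diag using diag_comp[OF e e system_abs_le] by (simp add: fun_eq_iff)
  \<comment> \<open>Positivity of \<open>diag s e e\<close>: it is the square of the self-adjoint
    diagonal operator with entries \<open>sqrt (s n)\<close>, so its quadratic form is a squared
    norm.\<close>
  have sqrt_le: "\<bar>sqrt (s n)\<bar> \<le> sqrt (s 0)" for n
    using system_abs_le[of n] system_pos[of n] by simp
  have sqrt: "diag s e e x = diag (\<lambda>n. sqrt (s n)) e e (diag (\<lambda>n. sqrt (s n)) e e x)" for x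
    using diag_comp[OF e e sqrt_le] less_imp_le[OF system_pos] by simp
  have "\<exists>r\<ge>0. ip (diag s e e x) x = of_real r" for x
    by (subst sqrt, subst ip_diag_adjoint[OF e e sqrt_le], subst ip_self)
      (rule exI[of _ "(norm (diag (\<lambda>n. sqrt (s n)) e e x))\<^sup>2"], simp)
  then show "positive_operator (diag s e e) \<and> diag s e e \<circ> diag s e e = adj A \<circ> A"
    unfolding positive_operator_def
    by (intro conjI allI square L_diag[OF e e system_abs_le] ip_diag_adjoint[OF e e system_abs_le])
  fix Q assume Q: "positive_operator Q \<and> Q \<circ> Q = adj A \<circ> A"
  then have QL: "Q \<in> L" and Q_sym: "\<And>x y. ip (Q x) y = ip x (Q y)"
    and Q_nonneg: "\<And>x. \<exists>r\<ge>0. ip (Q x) x = of_real r"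
    by (auto simp: positive_operator_def)
  have QQ: "Q (Q x) = diag (\<lambda>n. s n * s n) e e x" for x
    using Q adj_comp_eq_diag by (metis comp_apply)
  have square_le: "\<bar>s n * s n\<bar> \<le> s 0 * s 0" for n
    using mult_mono'[OF system_abs_le[of n] system_abs_le[of n]] by (simp only: abs_mult abs_ge_zero)
  show "Q = diag s e e"
  proof (rule L_eq_diag[OF QL e e system_abs_le])
    fix n
    \<comment> \<open>As \<open>Q + s n\<close> annihilates \<open>w\<close> by the equation for the
      squares, \<open>w\<close> would be an eigenvector for \<open>- s n < 0\<close>, which
      positivity of \<open>Q\<close> excludes.\<close>
    define w where "w = Q (e n) - s n *\<^sub>R e n"
    have "Q w = - (s n *\<^sub>R w)"
      by (simp add: w_def L_map_diff[OF QL] L_map_scaleR[OF QL] QQ diag_basis[OF e e square_le]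
          scaleR_diff_right)
    obtain r where "r \<ge> 0" "ip (Q w) w = of_real r" using Q_nonneg by blast
    then have "of_real r = (of_real (- (s n * (norm w)\<^sup>2)) :: 'k)"
      using \<open>Q w = _\<close> by (simp add: ip_scaleR_left ip_self)
    then have "r = - (s n * (norm w)\<^sup>2)" by (simp only: of_real_eq_iff)
    then have "s n * (norm w)\<^sup>2 \<le> 0" using \<open>r \<ge> 0\<close> by linarith
    then have "w = 0" using system_pos[of n] by (simp add: mult_le_0_iff)
    then show "Q (e n) = s n *\<^sub>R e n" by (simp add: w_def)
  next
    fix x assume "\<And>n. ip x (e n) = 0"
    then have "Q (Q x) = 0" by (simp add: QQ diag_def)
    then have "ip (Q x) (Q x) = 0" by (simp add: Q_sym)
    then show "Q x = 0" by simp
  qed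
qed

lemma finite_level_set: "t > 0 \<Longrightarrow> finite {n. s n = t}"
proof -
  assume "t > 0"
  with system_tendsto have "\<forall>\<^sub>F n in sequentially. s n < t" by (rule order_tendstoD)
  then obtain N where "\<And>n. n \<ge> N \<Longrightarrow> s n < t" by (auto simp: eventually_sequentially)
  then have "{n. s n = t} \<subseteq> {..<N}" by (force simp: not_le[symmetric])
  then show ?thesis by (rule finite_subset) simp
qed

text \<open>Removing from an eigenvector its components with \<open>s n = t\<close> leaves a vector
  \<open>z\<close> in the same eigenspace. The other coefficients of \<open>z\<close> vanish because
  \<open>s n \<noteq> t\<close>, so the operator kills \<open>z\<close>, and \<open>t > 0\<close>
  gives \<open>z = 0\<close>.\<close>

lemma eigenspace_eq_span:
  assumes "t > 0"
  shows "eigenspace (diag s e e) (of_real t) = span (e ` {n. s n = t})"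
proof
  note e = system_orthonormal
  define P where "P = diag s e e"
  define I where "I = {n. s n = t}"
  have PL: "P \<in> L" unfolding P_def by (rule L_diag[OF e e system_abs_le])
  have Pe: "P (e n) = s n *\<^sub>R e n" for n unfolding P_def by (rule diag_basis[OF e e system_abs_le])
  show "eigenspace (diag s e e) (of_real t) \<subseteq> span (e ` {n. s n = t})"
  proof
    fix x assume "x \<in> eigenspace (diag s e e) (of_real t)"
    then have Px: "P x = t *\<^sub>R x" by (simp add: eigenspace_def P_def scale_of_real)
    define p where "p = (\<Sum>n\<in>I. scale (ip x (e n)) (e n))"
    have "P p = t *\<^sub>R p"
      unfolding p_def L_map_sum[OF PL] scaleR_sum_right
      by (intro sum.cong) (auto simp: Pe I_def scale_left_commute simp flip: scale_of_real)
    then have Pz: "P (x - p) = t *\<^sub>R (x - p)"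
      by (simp add: L_map_diff[OF PL] Px scaleR_diff_right)
    have "ip (x - p) (e n) = 0" for n
    proof (cases "n \<in> I")
      case True
      then show ?thesis
        using finite_level_set[OF assms]
        by (simp add: p_def ip_diff_left ip_orthonormal_seq_sum[OF e] I_def)
    next
      case False
      have "of_real (s n) * ip (x - p) (e n) = of_real t * ip (x - p) (e n)"
        using ip_diag[OF e e, of s "s 0" "x - p" n] system_abs_le Pz
        by (simp only: ip_scaleR_left flip: P_def)
      with False show ?thesis by (auto simp: I_def)
    qed
    then have "P (x - p) = 0" by (simp add: P_def diag_def)
    with Pz assms have "x = p" by simp
    moreover have "p \<in> span (e ` {n. s n = t})"
      unfolding p_def I_def by (intro span_sum span_scale span_base) auto
    ultimately show "x \<in> span (e ` {n. s n = t})" by simp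
  qed
  have "P x = scale (of_real t) x" if "x \<in> span (e ` I)" for x
    using that
    by (induction rule: span_induct_alt)
      (auto simp: L_map_zero[OF PL] L_map_add[OF PL] L_scale[OF PL] Pe I_def scale_right_distrib
        scale_of_real scale_left_commute simp flip: scale_of_real)
  then show "span (e ` {n. s n = t}) \<subseteq> eigenspace (diag s e e) (of_real t)"
    by (auto simp: eigenspace_def P_def I_def)
qed

text \<open>The indices with \<open>s n = t\<close> label an orthonormal basis of the
  \<open>t\<close>-eigenspace, so the multiplicities are right, and they determine the
  sequence.\<close>

lemma s_number_eq: "s_number A = s"
  unfolding s_number_def sqrt_eq_diag
proof (rule the_equality)
  have dim: "card {n. s n = t} = dim (eigenspace (diag s e e) (of_real t))" if "t > 0" for t
    using dim_span_eq_card_independent[OF orthonormal_seq_independent[OF system_orthonormal]]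
      card_image[OF inj_on_subset[OF orthonormal_seq_inj[OF system_orthonormal] subset_UNIV]]
    by (simp add: eigenspace_eq_span[OF that])
  then show "decseq s \<and> (\<forall>n. s n \<ge> 0) \<and> (\<forall>t>0. finite {n. s n = t} \<and>
      card {n. s n = t} = dim (eigenspace (diag s e e) (of_real t)))"
    using system_decseq less_imp_le[OF system_pos] finite_level_set by blast
  fix u assume "decseq u \<and> (\<forall>n. u n \<ge> 0) \<and> (\<forall>t>0. finite {n. u n = t} \<and>
      card {n. u n = t} = dim (eigenspace (diag s e e) (of_real t)))"
  then show "u = s"
    using system_decseq less_imp_le[OF system_pos] finite_level_set dim
    by (intro decseq_eqI_level_sets) auto
qed

subsection \<open>Operators expanding the seminorm induced by A\<close>

lemma ip_adj: "ip (A x) y = ip x (adj A y)"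
  unfolding adj_eq_diag
  by (subst system_eq_diag)
    (rule ip_diag_adjoint[OF system_orthonormal left_vectors_orthonormal
      system_abs_le])

text \<open>The images of the \<open>e i\<close> are orthogonal, with norms
  \<open>s i \<ge> s N\<close> for \<open>i \<le> N\<close>. This is the lower half of the min-max
  principle.\<close>

lemma system_span_lower:
  assumes x: "x \<in> span (e ` {..N})"
  shows "s N * norm x \<le> norm (A x)"
proof (rule power2_le_imp_le)
  note e = system_orthonormal
  have x_eq: "x = (\<Sum>i\<le>N. scale (ip x (e i)) (e i))"
    by (rule expand_orthonormal_seq[OF e _ x]) simp
  have orth: "ip (A (scale c (e i))) (A (scale d (e j))) = 0" if "i \<noteq> j" for i j c d
  proof -
    have "ip (A (scale d (e j))) (A (e i)) = 0"
      using that system_coeff by (simp add: ip_scale_left orthonormal_seq_ip[OF e])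
    then have "ip (A (e i)) (A (scale d (e j))) = 0" using ip_eq_zero_commute by blast
    then show ?thesis by (simp add: L_scale[OF system_L] ip_scale_left)
  qed
  have "A x = (\<Sum>i\<le>N. A (scale (ip x (e i)) (e i)))"
    using arg_cong[OF x_eq, of A]
    by (simp only: L_map_sum[OF system_L] L_scale[OF system_L])
  then have "(norm (A x))\<^sup>2 = (\<Sum>i\<le>N. (norm (A (scale (ip x (e i)) (e i))))\<^sup>2)"
    using norm_sum_square_orthogonal[OF _ orth, of "{..N}"] by simp
  also have "\<dots> = (\<Sum>i\<le>N. (s i)\<^sup>2 * (norm (ip x (e i)))\<^sup>2)"
    by (simp add: L_scale[OF system_L] system_norm power_mult_distrib
        mult.commute)
  also have "\<dots> \<ge> (\<Sum>i\<le>N. (s N)\<^sup>2 * (norm (ip x (e i)))\<^sup>2)"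
    using decseqD[OF system_decseq] less_imp_le[OF system_pos]
    by (intro sum_mono mult_right_mono power_mono) auto
  also have "(\<Sum>i\<le>N. (s N)\<^sup>2 * (norm (ip x (e i)))\<^sup>2) = (s N * norm x)\<^sup>2"
    using norm_orthonormal_seq_sum[OF e, of "{..N}" "\<lambda>i. ip x (e i)"]
    by (simp add: power_mult_distrib flip: sum_distrib_left x_eq)
  finally show "(s N * norm x)\<^sup>2 \<le> (norm (A x))\<^sup>2" .
qed simp

lemma system_independent: "independent (e ` I)" "card (e ` I) = card I"
  using orthonormal_seq_independent[OF system_orthonormal]
    card_image[OF inj_on_subset[OF orthonormal_seq_inj[OF system_orthonormal]
      subset_UNIV]]
  by auto

section \<open>An expanding operator that moves the kernel bounds the ratios\<close>

text \<open>Both bounds concern \<open>Z = norm (A (S x))\<close> for one test vector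
  \<open>x\<close>. Orthogonality of \<open>S x\<close> to \<open>e 0\<close>, ...,
  \<open>e n\<close> bounds \<open>Z\<close> above by a multiple of
  \<open>s (Suc n) * norm x\<close>. For the lower bound, \<open>x\<close> is split into
  \<open>v\<close> and a multiple of \<open>x0\<close>: expansion controls \<open>v\<close>, and
  \<open>A (S x0) \<noteq> 0\<close> controls the multiple.\<close>

lemma ratio_bounded_if_ker_not_invariant:
  assumes S: "S \<in> E A" and x0: "A x0 = 0" "A (S x0) \<noteq> 0"
  shows "\<exists>c>0. \<forall>n. c * s n \<le> s (Suc n)"
proof -
  note AL = system_L
  have SL: "S \<in> L" and S_ge: "\<And>x. norm (A (S x)) \<ge> norm (A x)" using S by (auto simp: E_def)
  have ASL: "(\<lambda>x. A (S x)) \<in> L" by (rule L_comp[OF AL SL])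
  obtain K where K: "K > 0" "\<And>x. norm (S x) \<le> norm x * K"
    using bounded_linear.pos_bounded[OF L_bounded_linear[OF SL]] by blast
  obtain B where B: "B > 0" "\<And>x. norm (A (S x)) \<le> norm x * B"
    using bounded_linear.pos_bounded[OF L_bounded_linear[OF ASL]] by blast
  define \<delta> where "\<delta> = norm (A (S x0))"
  have "\<delta> > 0" using x0 by (simp add: \<delta>_def)
  \<comment> \<open>The summand \<open>1\<close> pays for \<open>v\<close>, the other one for the
    multiple of \<open>x0\<close>.\<close>
  define D where "D = norm x0 * (s 0 + B) / \<delta> + 1"
  have "s 0 > 0" by (rule system_pos)
  have "D > 0" using \<open>\<delta> > 0\<close> B(1) \<open>s 0 > 0\<close> by (simp add: D_def add_nonneg_pos)
  have "s n \<le> D * K * s (Suc n)" for n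
  proof -
    have x0_orth: "ip x0 (e i) = 0" for i
      using x0(1) system_ker_iff by blast
    have "x0 \<notin> e ` {..n}"
    proof
      assume "x0 \<in> e ` {..n}"
      then have "x0 = 0" using x0_orth by (metis imageE ip_self_eq_zero)
      then show False using x0 by (simp add: L_map_zero[OF ASL])
    qed
    moreover have "independent (insert x0 (e ` {..n}))"
    proof (rule independent_insertI[OF _ system_independent(1)])
      show "x0 \<notin> span (e ` {..n})"
      proof
        assume "x0 \<in> span (e ` {..n})"
        then have "x0 = (\<Sum>i\<le>n. scale (ip x0 (e i)) (e i))"
          by (intro expand_orthonormal_seq system_orthonormal) auto
        then have "x0 = 0" by (simp add: x0_orth)
        then show False using x0 by (simp add: L_map_zero[OF ASL])
      qed
    qed
    \<comment> \<open>There are \<open>n + 2\<close> independent vectors against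
      \<open>n + 1\<close> conditions.\<close>
    ultimately obtain x where x: "x \<in> span (insert x0 (e ` {..n}))" "x \<noteq> 0"
      "\<And>c. c \<in> e ` {..n} \<Longrightarrow> ip (S x) c = 0"
      using exists_orthogonal_in_span[OF SL, of "insert x0 (e ` {..n})" "e ` {..n}"] by auto
    then obtain t where t: "x - scale t x0 \<in> span (e ` {..n})"
      using span_breakdown_eq by blast
    define v where "v = x - scale t x0"
    define Z where "Z = norm (A (S x))"
    have "Z \<le> s (Suc n) * norm (S x)"
      unfolding Z_def by (rule system_max) (use x(3) in auto)
    also have "\<dots> \<le> s (Suc n) * (norm x * K)"
      using K(2) less_imp_le[OF system_pos] by (intro mult_left_mono) auto
    finally have Z_upper: "Z \<le> s (Suc n) * (norm x * K)" .
    have "s n * norm v \<le> norm (A v)"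
      using t unfolding v_def by (rule system_span_lower)
    also have "A v = A x"
      by (simp add: v_def L_map_diff[OF AL] L_scale[OF AL] x0)
    also have "norm (A x) \<le> Z" unfolding Z_def by (rule S_ge)
    finally have v: "s n * norm v \<le> Z" .
    have "A (S v) = A (S x) - scale t (A (S x0))"
      by (simp add: v_def L_map_diff[OF ASL] L_scale[OF ASL])
    then have "norm (scale t (A (S x0))) \<le> Z + norm v * B"
      using B(2)[of v] norm_triangle_ineq4[of "A (S x)" "A (S v)"] by (simp add: Z_def)
    then have t_le: "norm t \<le> (Z + norm v * B) / \<delta>"
      using \<open>\<delta> > 0\<close> by (simp add: \<delta>_def pos_le_divide_eq)
    have s_le: "s n \<le> s 0" using decseqD[OF system_decseq] by simp
    have s_pos: "s n > 0" by (rule system_pos)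
    have "Z \<ge> 0" by (simp add: Z_def)
    \<comment> \<open>The factor \<open>s n\<close> is needed since \<open>v\<close> is controlled
      only through \<open>s n * norm v \<le> Z\<close>; for the other term
      \<open>s n \<le> s 0\<close> is enough.\<close>
    have "s n * norm t \<le> s n * ((Z + norm v * B) / \<delta>)"
      using t_le s_pos by (intro mult_left_mono) auto
    also have "\<dots> = (s n * Z + (s n * norm v) * B) / \<delta>" by (simp add: algebra_simps)
    also have "\<dots> \<le> (s 0 * Z + Z * B) / \<delta>"
      using s_le v \<open>Z \<ge> 0\<close> B(1) \<open>\<delta> > 0\<close>
      by (intro divide_right_mono add_mono mult_right_mono) auto
    finally have "s n * norm t \<le> Z * ((s 0 + B) / \<delta>)" by (simp add: algebra_simps)
    then have "(s n * norm t) * norm x0 \<le> Z * ((s 0 + B) / \<delta>) * norm x0"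
      by (rule mult_right_mono) simp
    moreover have "norm x \<le> norm v + norm t * norm x0"
      using norm_triangle_ineq[of v "scale t x0"] by (simp add: v_def)
    then have "s n * norm x \<le> s n * norm v + (s n * norm t) * norm x0"
      using s_pos by (metis distrib_left less_imp_le mult.assoc mult_left_mono)
    ultimately have "s n * norm x \<le> Z * D"
      using v by (simp add: D_def algebra_simps)
    also have "\<dots> \<le> s (Suc n) * (norm x * K) * D"
      using Z_upper \<open>D > 0\<close> by (intro mult_right_mono) auto
    finally have "s n * norm x \<le> (D * K * s (Suc n)) * norm x" by (simp add: algebra_simps)
    then show ?thesis using x(2) by simp
  qed
  then have "\<forall>n. 1 / (D * K) * s n \<le> s (Suc n)"
    using \<open>D > 0\<close> K(1) by (simp add: pos_divide_le_eq mult.commute)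
  moreover have "1 / (D * K) > 0" using \<open>D > 0\<close> K(1) by simp
  ultimately show ?thesis by blast
qed

section \<open>Approximation of arbitrary operators under bounded ratios\<close>

text \<open>Min-max: \<open>n + card H + 1\<close> singular vectors span a space with a nonzero
  vector orthogonal to \<open>H\<close> and to the first \<open>n\<close> vectors
  \<open>f i\<close>. On it both the lower bound from the span and the upper bound from
  \<open>f n\<close> hold.\<close>

lemma singular_values_restriction_lower:
  assumes "finite H"
    and "\<And>n x. \<forall>h\<in>H. ip x h = 0 \<Longrightarrow> \<forall>i<n. ip x (f i) = 0 \<Longrightarrow>
      norm (A x) \<le> norm (A (f n)) * norm x"
  shows "s (n + card H) \<le> norm (A (f n))"
proof -
  have "card (H \<union> f ` {..<n}) \<le> card H + card (f ` {..<n})" by (rule card_Un_le)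
  also have "\<dots> \<le> card H + n" using card_image_le[of "{..<n}" f] by simp
  finally have "card (H \<union> f ` {..<n}) < card (e ` {..n + card H})"
    by (simp add: system_independent)
  then obtain x where x: "x \<in> span (e ` {..n + card H})" "x \<noteq> 0"
    "\<And>c. c \<in> H \<union> f ` {..<n} \<Longrightarrow> ip x c = 0"
    by (rule exists_orthogonal_in_span[OF L_id system_independent(1), rotated 2])
      (simp_all add: \<open>finite H\<close>)
  have "s (n + card H) * norm x \<le> norm (A x)"
    by (rule system_span_lower[OF x(1)])
  also have "\<dots> \<le> norm (A (f n)) * norm x"
    using x(3) by (intro assms(2)) auto
  finally show ?thesis using x(2) by simp
qed

text \<open>\<open>V\<close> sends \<open>e n\<close> to a multiple of the \<open>n\<close>-th
  singular vector \<open>f n\<close> of the restriction of \<open>A\<close> to the complement of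
  \<open>H\<close>, with the weight that restores the singular value \<open>s n\<close>. These
  weights are bounded because removing \<open>H\<close> shifts the indices by at most
  \<open>card H\<close>.\<close>

lemma exists_expanding_orthogonal:
  assumes A: "compact_operator A" and rank: "\<not> finite_dimensional (range A)"
    and c: "c > 0" "\<And>n. c * s n \<le> s (Suc n)" and "finite H"
  obtains V where "V \<in> L" "\<And>x. norm (A (V x)) = norm (A x)"
    "\<And>x h. h \<in> H \<Longrightarrow> ip (V x) h = 0"
proof -
  note AL = system_L and e = system_orthonormal
  obtain f where f: "orthonormal_seq f" "\<And>n h. h \<in> H \<Longrightarrow> ip (f n) h = 0" "\<And>n. A (f n) \<noteq> 0"
    and max: "\<And>n x. \<forall>h\<in>H. ip x h = 0 \<Longrightarrow> \<forall>i<n. ip x (f i) = 0 \<Longrightarrow>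
      norm (A x) \<le> norm (A (f n)) * norm x"
    and orth: "\<And>n x. \<forall>h\<in>H. ip x h = 0 \<Longrightarrow> \<forall>i\<le>n. ip x (f i) = 0 \<Longrightarrow>
      ip (A x) (A (f n)) = 0"
    by (rule singular_vectors[OF A rank \<open>finite H\<close>]) (rule that)
  define \<sigma> where "\<sigma> n = norm (A (f n))" for n
  have \<sigma>_pos: "\<sigma> n > 0" for n using f(3) by (simp add: \<sigma>_def)
  \<comment> \<open>Iterating the ratio bound absorbs the shift of the index by
    \<open>card H\<close>.\<close>
  have power: "c ^ k * s n \<le> s (n + k)" for n k
  proof (induction k)
    case (Suc k)
    have "c ^ Suc k * s n \<le> c * s (n + k)"
      using Suc c(1) by (simp add: mult.assoc)
    also have "\<dots> \<le> s (n + Suc k)" using c(2)[of "n + k"] by simp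
    finally show ?case .
  qed simp
  define a where "a n = s n / \<sigma> n" for n
  have a: "\<bar>a n\<bar> \<le> 1 / c ^ card H" for n
  proof -
    have "c ^ card H * s n \<le> \<sigma> n"
      unfolding \<sigma>_def
      by (rule order_trans[OF power singular_values_restriction_lower[OF \<open>finite H\<close> max]])
    then have "s n / \<sigma> n \<le> 1 / c ^ card H"
      using \<sigma>_pos[of n] c(1) by (simp add: field_simps)
    then show ?thesis using \<sigma>_pos[of n] system_pos[of n] by (simp add: a_def)
  qed
  define V where "V = diag a e f"
  have VL: "V \<in> L" unfolding V_def by (rule L_diag[OF e f(1) a])
  define h where "h n = (1 / \<sigma> n) *\<^sub>R A (f n)" for n
  have less: "ip (A (f n)) (A (f m)) = 0" if "m < n" for m n
    using that f(2) by (intro orth) (auto simp: orthonormal_seq_ip[OF f(1)])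
  have h: "orthonormal_seq h"
    unfolding orthonormal_seq_def
  proof (intro allI)
    fix i j
    have "ip (A (f i)) (A (f j)) = 0" if "i \<noteq> j"
      using less[of i j] less[of j i] ip_eq_zero_commute that by (cases "i < j") auto
    then show "ip (h i) (h j) = (if i = j then 1 else 0)"
      using \<sigma>_pos[of j] by (auto simp: h_def ip_scaleR_left ip_scaleR_right ip_self
          power2_eq_square simp flip: \<sigma>_def)
  qed
  \<comment> \<open>The composite has the weights and source vectors of \<open>A\<close> and differs
    only in the orthonormal target sequence, which does not affect norms.\<close>
  have "(\<lambda>x. A (V x)) = diag s e h"
  proof (rule L_eq_diag[OF L_comp[OF AL VL] e h system_abs_le])
    show "A (V (e n)) = s n *\<^sub>R h n" for n
      unfolding V_def by (simp add: diag_basis[OF e f(1) a] L_map_scaleR[OF AL] h_def a_def)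
    show "A (V x) = 0" if "\<And>n. ip x (e n) = 0" for x
      using that by (simp add: V_def diag_def L_map_zero[OF AL])
  qed
  then have "A (V x) = diag s e h x" for x by (rule fun_cong)
  then have "norm (A (V x)) = norm (diag s e h x)" for x by simp
  also have "norm (diag s e h x) = norm (diag s e left_vectors x)" for x
    by (rule norm_diag_eq[OF e h left_vectors_orthonormal system_abs_le])
  also have "diag s e left_vectors x = A x" for x
    by (rule fun_cong[OF system_eq_diag, symmetric])
  finally have "norm (A (V x)) = norm (A x)" for x .
  moreover have "ip (V x) h = 0" if "h \<in> H" for x h
    unfolding V_def using f(2)[OF that] by (rule diag_orthogonal[OF e f(1) a])
  ultimately show ?thesis using that VL by blast
qed

text \<open>\<open>C\<close> is an orthonormal set whose span contains \<open>G\<close>, and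
  \<open>P\<close> projects onto its span. Values of \<open>V\<close> orthogonal to \<open>C\<close>
  leave the coefficients of \<open>T\<close> intact; values orthogonal to all
  \<open>adj A (A c)\<close> make \<open>A (V x)\<close> orthogonal to \<open>A (P (T x))\<close>,
  so Pythagoras gives the expansion.\<close>

lemma E_approximation_if_ratio_bounded:
  assumes A: "compact_operator A" and rank: "\<not> finite_dimensional (range A)"
    and c: "c > 0" "\<And>n. c * s n \<le> s (Suc n)" and T: "T \<in> L" and "finite G"
  shows "\<exists>S\<in>E A. \<forall>x. \<forall>y\<in>G. ip (S x) y = ip (T x) y"
proof -
  note AL = system_L
  obtain C where C: "finite C" "orthonormal_for (\<lambda>x. x) C"
    and G: "\<And>y. y \<in> G \<Longrightarrow> y - expand_for (\<lambda>x. x) C y = 0"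
    using gram_schmidt[OF L_id \<open>finite G\<close>] by metis
  define P where "P = expand_for (\<lambda>x. x) C"
  have PL: "P \<in> L" unfolding P_def by (rule L_expand_for[OF L_id])
  have "finite (C \<union> (\<lambda>c. adj A (A c)) ` C)" using C(1) by simp
  then obtain V where V: "V \<in> L" "\<And>x. norm (A (V x)) = norm (A x)"
    "\<And>x h. h \<in> C \<union> (\<lambda>c. adj A (A c)) ` C \<Longrightarrow> ip (V x) h = 0"
    by (rule exists_expanding_orthogonal[OF A rank c]) (rule that)
  define S where "S x = P (T x) + V x" for x
  have "S \<in> L" unfolding S_def[abs_def] by (intro L_add L_comp[OF PL T] V)
  moreover have "norm (A x) \<le> norm (A (S x))" for x
  proof (rule power2_le_imp_le)
    have zero: "ip (A c) (A (V x)) = 0" if "c \<in> C" for c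
    proof -
      have "ip (A (V x)) (A c) = 0"
        unfolding ip_adj by (rule V(3)) (use that in simp)
      then show ?thesis using ip_eq_zero_commute by blast
    qed
    have "ip (A (P (T x))) (A (V x)) = 0"
      unfolding P_def expand_for_def L_map_sum[OF AL] ip_sum_left ip_scale_left
      by (intro sum.neutral) (simp add: zero)
    then have "(norm (A (S x)))\<^sup>2 = (norm (A (P (T x))))\<^sup>2 + (norm (A (V x)))\<^sup>2"
      by (simp add: S_def L_map_add[OF AL] norm_add_square_orthogonal)
    then show "(norm (A x))\<^sup>2 \<le> (norm (A (S x)))\<^sup>2" by (simp add: V(2))
  qed simp
  moreover have "ip (S x) y = ip (T x) y" if "y \<in> G" for x y
  proof -
    have coeff: "ip (S x) c = ip (T x) c" if "c \<in> C" for c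
      using ip_expand_for[OF L_id C that] V(3) that by (simp add: S_def P_def ip_add_left)
    have "ip (S x) y = (\<Sum>c\<in>C. ip c y * ip (S x) c)"
      by (rule ip_gram_schmidt_right[OF G[OF that]])
    also have "\<dots> = (\<Sum>c\<in>C. ip c y * ip (T x) c)"
      by (simp add: coeff)
    also have "\<dots> = ip (T x) y"
      by (rule ip_gram_schmidt_right[OF G[OF that], symmetric])
    finally show ?thesis .
  qed
  ultimately show ?thesis unfolding E_def by blast
qed

section \<open>Approximation of operators that preserve the kernel\<close>

text \<open>Orthogonality of \<open>A x\<close> to \<open>A d\<close> is orthogonality of
  \<open>x\<close> to \<open>adj A (A d)\<close>, so each new vector faces finitely many conditions
  \<open>H\<close>. The span of \<open>card H + 1\<close> singular vectors meets them nontrivially,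
  and \<open>A\<close> is injective on it, which permits normalization.\<close>

lemma exists_orthonormal_family_for:
  assumes "finite I" "finite G" "finite D"
  shows "\<exists>u. \<forall>i\<in>I. (\<forall>g\<in>G. ip (u i) g = 0) \<and> (\<forall>d\<in>D. ip (A (u i)) (A d) = 0) \<and>
    (\<forall>j\<in>I. ip (A (u i)) (A (u j)) = (if i = j then 1 else 0))"
  using \<open>finite I\<close>
proof (induction I)
  case (insert i I)
  note AL = system_L
  from insert.IH obtain u where u: "\<And>i g. i \<in> I \<Longrightarrow> g \<in> G \<Longrightarrow> ip (u i) g = 0"
    "\<And>i d. i \<in> I \<Longrightarrow> d \<in> D \<Longrightarrow> ip (A (u i)) (A d) = 0"
    "\<And>i j. i \<in> I \<Longrightarrow> j \<in> I \<Longrightarrow> ip (A (u i)) (A (u j)) = (if i = j then 1 else 0)"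
    by blast
  define H where "H = G \<union> (\<lambda>d. adj A (A d)) ` (D \<union> u ` I)"
  have "finite H" using assms insert.hyps by (simp add: H_def)
  then obtain x where x: "x \<in> span (e ` {..card H})" "x \<noteq> 0" "\<And>c. c \<in> H \<Longrightarrow> ip x c = 0"
    by - (rule exists_orthogonal_in_span[OF L_id system_independent(1), of "{..card H}" H],
        simp_all add: system_independent)
  have "0 < s (card H) * norm x" using x(2) system_pos by simp
  also have "\<dots> \<le> norm (A x)" by (rule system_span_lower[OF x(1)])
  finally have "A x \<noteq> 0" by simp
  define v where "v = (1 / norm (A x)) *\<^sub>R x"
  have Av: "A v = (1 / norm (A x)) *\<^sub>R A x" by (simp add: v_def L_map_scaleR[OF AL])
  have v: "ip (A v) (A v) = 1" using \<open>A x \<noteq> 0\<close> by (simp add: ip_self Av)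
  have vG: "ip v g = 0" if "g \<in> G" for g
    using x(3)[of g] that by (simp add: v_def ip_scaleR_left H_def)
  have vD: "ip (A v) (A d) = 0" if "d \<in> D \<union> u ` I" for d
    using x(3)[of "adj A (A d)"] that
    by (simp add: Av ip_scaleR_left H_def ip_adj)
  have uv: "ip (A (u j)) (A v) = 0" if "j \<in> I" for j
    using vD[of "u j"] that ip_eq_zero_commute by blast
  show ?case
  proof (rule exI[of _ "u(i := v)"], intro ballI conjI)
    fix j k assume "j \<in> insert i I" "k \<in> insert i I"
    then show "ip (A ((u(i := v)) j)) (A ((u(i := v)) k)) = (if j = k then 1 else 0)"
      using u(3) v vD uv insert.hyps(2) by auto
  qed (use u vG vD in \<open>auto split: if_splits\<close>)
qed simp

text \<open>\<open>S\<close> acts as \<open>T\<close> on \<open>x - R x\<close> and enlarges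
  \<open>R x\<close> by \<open>\<mu>\<close>; the added \<open>\<mu> *\<^sub>R U x\<close> is
  orthogonal to \<open>G\<close>. From \<open>A (S x)\<close> the functionals \<open>a c\<close>
  bound the coefficients \<open>a c x\<close>, and once these are under control so is all of
  \<open>A x\<close>.\<close>

lemma E_approximation_if_ker_invariant:
  assumes T: "T \<in> L" and ker_inv: "\<And>x. A x = 0 \<Longrightarrow> A (T x) = 0"
    and "finite F" "finite G"
  shows "\<exists>S\<in>E A. \<forall>x\<in>F. \<forall>y\<in>G. ip (S x) y = ip (T x) y"
proof -
  note AL = system_L and e = system_orthonormal
  \<comment> \<open>The orthogonal projection onto the complement of \<open>ker A\<close>.\<close>
  define Q where "Q = diag (\<lambda>_. 1) e e"
  have one: "\<bar>1::real\<bar> \<le> 1" by simp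
  have QL: "Q \<in> L" unfolding Q_def by (rule L_diag[OF e e one])
  have AQ: "A (Q x) = A x" for x
  proof -
    have "A (x - Q x) = 0"
      unfolding system_ker_iff Q_def by (simp add: ip_residual[OF e])
    then show ?thesis by (simp add: L_map_diff[OF AL])
  qed
  have Q_zero: "Q x = 0" if "A x = 0" for x
    using that by (simp add: system_ker_iff Q_def diag_def)
  have QQ: "Q (Q x) = Q x" for x
    unfolding Q_def using diag_comp[OF e e one, of "\<lambda>_. 1" e x] by simp
  obtain C where C: "finite C" "C \<subseteq> span (Q ` F)" "orthonormal_for A C"
    and F: "\<And>x. x \<in> Q ` F \<Longrightarrow> A (x - expand_for A C x) = 0"
    using gram_schmidt[OF AL, of "Q ` F"] \<open>finite F\<close> by auto
  have QC: "Q c = c" if "c \<in> C" for c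
  proof -
    have "c \<in> span (Q ` F)" using that C(2) by blast
    then show ?thesis
      by (induction rule: span_induct_alt)
        (auto simp: QQ L_map_zero[OF QL] L_map_add[OF QL] L_scale[OF QL])
  qed
  have CC: "ip (A c) (A d) = (if c = d then 1 else 0)" if "c \<in> C" "d \<in> C" for c d
    using C(3) that by (simp add: orthonormal_for_def)
  obtain u where uG: "\<And>c g. c \<in> C \<Longrightarrow> g \<in> G \<Longrightarrow> ip (u c) g = 0"
    and uC: "\<And>c d. c \<in> C \<Longrightarrow> d \<in> C \<Longrightarrow> ip (A (u c)) (A d) = 0"
    and uu: "\<And>c d. c \<in> C \<Longrightarrow> d \<in> C \<Longrightarrow> ip (A (u c)) (A (u d)) = (if c = d then 1 else 0)"
    using exists_orthonormal_family_for[OF C(1) \<open>finite G\<close> C(1)] by metis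
  have Cu: "ip (A c) (A (u d)) = 0" if "c \<in> C" "d \<in> C" for c d
    using uC[OF that(2,1)] ip_eq_zero_commute by blast
  txt \<open>
    For \<open>x\<close> in the span of \<open>C\<close>, \<open>a c x\<close> is the coefficient of \<open>c\<close>. The summand \<open>A (u c)\<close> makes
    \<open>a\<close> recover the same coefficients from the image of \<open>x\<close> under the map \<open>c \<mapsto> u c\<close>.
  \<close>
  define a where "a c x = ip (A x) (A c + A (u c))" for c x
  have norm_AC: "norm (A c) = 1" "norm (A (u c)) = 1" if "c \<in> C" for c
  proof -
    have "of_real ((norm (A c))\<^sup>2) = (of_real (1\<^sup>2) :: 'k)"
      "of_real ((norm (A (u c)))\<^sup>2) = (of_real (1\<^sup>2) :: 'k)"
      using CC[OF that that] uu[OF that that] unfolding ip_self[symmetric] by simp_all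
    then show "norm (A c) = 1" "norm (A (u c)) = 1"
      unfolding of_real_eq_iff by (simp_all only: power2_eq_iff_nonneg[OF norm_ge_zero zero_le_one])
  qed
  have norm_a: "norm (a c x) \<le> 2 * norm (A x)" if "c \<in> C" for c x
  proof -
    have "norm (a c x) \<le> norm (A x) * norm (A c + A (u c))"
      unfolding a_def by (rule norm_ip_le)
    also have "\<dots> \<le> norm (A x) * 2"
      using norm_triangle_ineq[of "A c" "A (u c)"] norm_AC[OF that] by (intro mult_left_mono) auto
    finally show ?thesis by simp
  qed
  have a_C: "a d c = (if c = d then 1 else 0)" "a d (u c) = (if c = d then 1 else 0)"
    if "c \<in> C" "d \<in> C" for c d
    using that by (auto simp: a_def ip_add_right CC Cu uC uu)
  have a_Q: "a c (Q x) = a c x" for c x by (simp add: a_def AQ)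
  have a_sum: "a d (\<Sum>c\<in>C. scale (b c) (g c)) = (\<Sum>c\<in>C. b c * a d (g c))" for d b g
    by (simp add: a_def L_map_sum[OF AL] ip_sum_left ip_scale_left)
  have a_diff: "a d (x - y) = a d x - a d y" and a_add: "a d (x + y) = a d x + a d y" for d x y
    by (simp_all add: a_def L_map_diff[OF AL] L_map_add[OF AL] ip_diff_left ip_add_left)
  have a_scaleR: "a d (r *\<^sub>R x) = of_real r * a d x" for d r x
    by (simp add: a_def L_map_scaleR[OF AL] ip_scaleR_left)
  have a_delta: "(\<Sum>c\<in>C. b c * (if c = d then 1 else 0)) = b d" if "d \<in> C" for b :: "'a \<Rightarrow> 'k" and d
    using that C(1) by (simp add: if_distrib[of "\<lambda>t. _ * t"] cong: if_cong)
  \<comment> \<open>The component of \<open>Q x\<close> in the common kernel of the functionals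
    \<open>a c\<close>, taken along the span of \<open>C\<close>.\<close>
  define R where "R x = Q x - (\<Sum>c\<in>C. scale (a c x) c)" for x
  have a_R: "a d (R x) = 0" if "d \<in> C" for d x
  proof -
    have "(\<Sum>c\<in>C. a c x * a d c) = (\<Sum>c\<in>C. a c x * (if c = d then 1 else 0))"
      using that by (intro sum.cong) (auto simp: a_C)
    then show ?thesis
      using that by (simp add: R_def a_diff a_Q a_sum a_delta)
  qed
  define k where "k = real (card C)"
  define M where "M = (\<Sum>c\<in>C. norm (A (T c)))"
  have "M \<ge> 0" "k \<ge> 0" by (simp_all add: M_def k_def sum_nonneg)
  \<comment> \<open>In the final estimate \<open>1\<close> pays for \<open>A (S x)\<close>,
    \<open>4 * k * M\<close> for the images \<open>A (T c)\<close>, and \<open>8 * k\<close> for the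
    two sums over \<open>A (u c)\<close> and \<open>A c\<close>; the total is exactly
    \<open>\<mu> * Y\<close>.\<close>
  define \<mu> where "\<mu> = 1 + 4 * k * M + 8 * k"
  have \<mu>: "\<mu> \<ge> 1" "\<mu> \<ge> 4 * k * M" using \<open>M \<ge> 0\<close> \<open>k \<ge> 0\<close> by (simp_all add: \<mu>_def)
  define U where "U x = (\<Sum>c\<in>C. scale (a c x) (u c))" for x
  define S where "S x = T (x - R x) + \<mu> *\<^sub>R (R x + U x)" for x
  have sum_L: "(\<lambda>x. \<Sum>c\<in>C. scale (a c x) (g c)) \<in> L" for g
    unfolding a_def by (intro L_sum L_rank_one AL)
  have RL: "R \<in> L" unfolding R_def[abs_def] by (intro L_diff QL sum_L)
  have UL: "U \<in> L" unfolding U_def[abs_def] by (rule sum_L)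
  have "S \<in> L"
    unfolding S_def[abs_def] by (intro L_add L_scaleR L_comp[OF T] L_diff L_id RL UL)
  moreover have "norm (A x) \<le> norm (A (S x))" for x
  proof -
    define Y where "Y = norm (A (S x))"
    define \<alpha> where "\<alpha> = (\<Sum>c\<in>C. norm (a c x))"
    have "\<alpha> \<ge> 0" "Y \<ge> 0" by (simp_all add: \<alpha>_def Y_def sum_nonneg)
    have ATR: "A (T (x - R x)) = (\<Sum>c\<in>C. scale (a c x) (A (T c)))"
    proof -
      \<comment> \<open>Here the invariance of \<open>ker A\<close> enters: only the finitely many
        coefficients of \<open>x\<close> survive in \<open>A (T (x - R x))\<close>.\<close>
      have "A (T (x - Q x)) = 0"
        by (rule ker_inv) (simp add: L_map_diff[OF AL] AQ)
      moreover have "x - R x = (x - Q x) + (\<Sum>c\<in>C. scale (a c x) c)" by (simp add: R_def)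
      ultimately show ?thesis
        by (simp only: L_map_add[OF T] L_map_add[OF AL] L_map_sum[OF T] L_map_sum[OF AL]) simp
    qed
    have sum_bound: "norm (\<Sum>c\<in>C. scale (a c x) (A (T c))) \<le> M * \<alpha>"
    proof -
      have "norm (\<Sum>c\<in>C. scale (a c x) (A (T c))) \<le> (\<Sum>c\<in>C. norm (a c x) * norm (A (T c)))"
        by (rule order_trans[OF norm_sum]) simp
      also have "\<dots> \<le> (\<Sum>c\<in>C. norm (a c x) * M)"
        unfolding M_def using C(1) by (intro sum_mono mult_left_mono member_le_sum) auto
      also have "\<dots> = M * \<alpha>"
        unfolding \<alpha>_def sum_distrib_right[symmetric] by (rule mult.commute)
      finally show ?thesis .
    qed
    \<comment> \<open>In \<open>a d (S x)\<close> the term from \<open>R x\<close> vanishes, while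
      \<open>U x\<close> has the same coefficient as \<open>x\<close>.\<close>
    have "\<mu> * norm (a d x) \<le> 2 * Y + 2 * (M * \<alpha>)" if "d \<in> C" for d
    proof -
      have "a d (U x) = (\<Sum>c\<in>C. a c x * (if c = d then 1 else 0))"
        unfolding U_def a_sum using that by (intro sum.cong) (auto simp: a_C)
      then have "a d (S x) = a d (T (x - R x)) + of_real \<mu> * a d x"
        using that by (simp add: S_def a_add a_scaleR a_R a_delta)
      then have "\<mu> * norm (a d x) = norm (a d (S x) - a d (T (x - R x)))"
        using \<mu>(1) by (simp add: norm_mult)
      also have "\<dots> \<le> norm (a d (S x)) + norm (a d (T (x - R x)))" by (rule norm_triangle_ineq4)
      also have "\<dots> \<le> 2 * Y + 2 * (M * \<alpha>)"
        using norm_a[OF that, of "S x"] norm_a[OF that, of "T (x - R x)"] sum_bound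
        by (simp add: Y_def ATR)
      finally show ?thesis .
    qed
    then have "(\<Sum>d\<in>C. \<mu> * norm (a d x)) \<le> (\<Sum>d\<in>C. 2 * Y + 2 * (M * \<alpha>))" by (rule sum_mono)
    then have "\<mu> * \<alpha> \<le> k * (2 * Y + 2 * (M * \<alpha>))"
      by (simp only: \<alpha>_def[symmetric] k_def sum_distrib_left[symmetric] sum_constant of_nat_id)
    then have "\<mu> * \<alpha> \<le> 2 * k * Y + 2 * k * M * \<alpha>"
      by (simp add: algebra_simps)
    \<comment> \<open>Shows that \<open>2 * k * M * \<alpha>\<close> is at most half of
      \<open>\<mu> * \<alpha>\<close>, so it can be absorbed.\<close>
    moreover have "4 * k * M * \<alpha> \<le> \<mu> * \<alpha>" using \<mu>(2) \<open>\<alpha> \<ge> 0\<close> by (rule mult_right_mono)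
    ultimately have \<alpha>: "\<mu> * \<alpha> \<le> 4 * k * Y" by linarith
    have "1 * \<alpha> \<le> \<mu> * \<alpha>" using \<mu>(1) \<open>\<alpha> \<ge> 0\<close> by (rule mult_right_mono)
    then have "\<alpha> \<le> 4 * k * Y" using \<alpha> by simp
    then have M\<alpha>: "M * \<alpha> \<le> M * (4 * k * Y)" using \<open>M \<ge> 0\<close> by (rule mult_left_mono)
    have unit_bound: "norm (\<Sum>c\<in>C. scale (a c x) (A (g c))) \<le> \<alpha>"
      if "\<And>c. c \<in> C \<Longrightarrow> norm (A (g c)) = 1" for g
      unfolding \<alpha>_def using that by (intro order_trans[OF norm_sum]) simp
    \<comment> \<open>The definition of \<open>S\<close>, solved for \<open>A (R x)\<close>, with
      the removed combination of the \<open>A c\<close> restored.\<close>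
    have "\<mu> *\<^sub>R A x = A (S x) - (\<Sum>c\<in>C. scale (a c x) (A (T c)))
        - \<mu> *\<^sub>R (\<Sum>c\<in>C. scale (a c x) (A (u c))) + \<mu> *\<^sub>R (\<Sum>c\<in>C. scale (a c x) (A c))"
    proof -
      have "A (R x) = A x - (\<Sum>c\<in>C. scale (a c x) (A c))"
        by (simp add: R_def L_map_diff[OF AL] AQ L_map_sum[OF AL])
      moreover have "A (U x) = (\<Sum>c\<in>C. scale (a c x) (A (u c)))"
        by (simp add: U_def L_map_sum[OF AL])
      ultimately show ?thesis
        by (simp add: S_def L_map_add[OF AL] L_map_scaleR[OF AL] ATR scaleR_add_right
            scaleR_diff_right)
    qed
    moreover have "norm (w - p - q + r) \<le> norm w + norm p + norm q + norm r" for w p q r :: 'a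
      using norm_triangle_ineq[of "w - p - q" r] norm_triangle_ineq4[of "w - p" q]
        norm_triangle_ineq4[of w p] by linarith
    ultimately have "norm (\<mu> *\<^sub>R A x) \<le> Y + norm (\<Sum>c\<in>C. scale (a c x) (A (T c)))
        + norm (\<mu> *\<^sub>R (\<Sum>c\<in>C. scale (a c x) (A (u c))))
        + norm (\<mu> *\<^sub>R (\<Sum>c\<in>C. scale (a c x) (A c)))"
      unfolding Y_def by (simp only:)
    moreover have "norm (\<mu> *\<^sub>R (\<Sum>c\<in>C. scale (a c x) (A (g c)))) \<le> \<mu> * \<alpha>"
      if "\<And>c. c \<in> C \<Longrightarrow> norm (A (g c)) = 1" for g
      using unit_bound[of g, OF that] \<mu>(1) by (simp add: mult_left_mono)
    from this[of u] this[of "\<lambda>c. c"]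
    have "norm (\<mu> *\<^sub>R (\<Sum>c\<in>C. scale (a c x) (A (u c)))) \<le> \<mu> * \<alpha>"
      "norm (\<mu> *\<^sub>R (\<Sum>c\<in>C. scale (a c x) (A c))) \<le> \<mu> * \<alpha>"
      using norm_AC by blast+
    moreover have "norm (\<mu> *\<^sub>R A x) = \<mu> * norm (A x)" using \<mu>(1) by simp
    ultimately have "\<mu> * norm (A x) \<le> Y + M * (4 * k * Y) + 2 * (4 * k * Y)"
      using sum_bound \<alpha> M\<alpha> by linarith
    also have "\<dots> = \<mu> * Y" by (simp add: \<mu>_def algebra_simps)
    finally show ?thesis using \<mu>(1) by (simp add: Y_def)
  qed
  moreover have "ip (S x) y = ip (T x) y" if "x \<in> F" "y \<in> G" for x y
  proof -
    \<comment> \<open>\<open>Q\<close> kills \<open>ker A\<close> and fixes the vectors of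
      \<open>C\<close>, so the expansion of \<open>Q x\<close> modulo \<open>ker A\<close> becomes
      exact.\<close>
    have "Q (Q x - expand_for A C (Q x)) = 0"
      using F[of "Q x"] that(1) by (intro Q_zero) auto
    moreover have "Q (expand_for A C z) = expand_for A C z" for z
      unfolding expand_for_def L_map_sum[OF QL] by (intro sum.cong) (auto simp: QC)
    ultimately have Qx: "Q x = expand_for A C (Q x)"
      by (simp add: L_map_diff[OF QL] QQ)
    \<comment> \<open>For \<open>x\<close> in \<open>F\<close> the summand \<open>A (u c)\<close> in
      \<open>a\<close> contributes nothing, so \<open>a c x\<close> is the true coefficient,
      \<open>R x = 0\<close>, and \<open>S x\<close> differs from \<open>T x\<close> by a multiple
      of \<open>U x\<close>.\<close>
    have "ip (A x) (A (u c)) = 0" if "c \<in> C" for c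
    proof -
      have "ip (A x) (A (u c)) = ip (A (expand_for A C (Q x))) (A (u c))"
        using Qx AQ by metis
      also have "\<dots> = 0"
        unfolding expand_for_def L_map_sum[OF AL] ip_sum_left ip_scale_left
        using that by (intro sum.neutral) (simp add: Cu)
      finally show ?thesis .
    qed
    then have "a c x = ip (A (Q x)) (A c)" if "c \<in> C" for c
      using that by (simp add: a_def ip_add_right AQ)
    then have "(\<Sum>c\<in>C. scale (a c x) c) = expand_for A C (Q x)"
      unfolding expand_for_def by (intro sum.cong) auto
    then have "R x = 0" using Qx by (simp add: R_def)
    moreover have "ip (U x) y = 0"
      unfolding U_def ip_sum_left ip_scale_left
      using uG that(2) by (intro sum.neutral) auto
    ultimately show ?thesis by (simp add: S_def ip_add_left ip_scaleR_left)
  qed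
  ultimately show ?thesis unfolding E_def by blast
qed

end

section \<open>The two cases put together\<close>

lemma WE_eq:
  assumes A: "compact_operator A" and rank: "\<not> finite_dimensional (range A)"
  shows "(\<not> lacunary (s_number A) \<longrightarrow> WE A = L) \<and>
    (lacunary (s_number A) \<longrightarrow> WE A = {T \<in> L. invariant_under T (ker A)})"
proof -
  obtain e s where system: "singular_system A e s"
    by (rule exists_singular_system[OF A rank])
  note AL = system_L[OF system]
  have lacunary_iff: "\<not> lacunary (s_number A) \<longleftrightarrow> (\<exists>c>0. \<forall>n. c * s n \<le> s (Suc n))"
    unfolding s_number_eq[OF system] by (rule not_lacunary_iff[OF system_pos[OF system]])
  have invariant_iff: "invariant_under T (ker A) \<longleftrightarrow> (\<forall>x. A x = 0 \<longrightarrow> A (T x) = 0)" for T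
  proof -
    have "subspace (ker A)"
      by (auto simp: ker_def L_map_zero[OF AL] L_map_add[OF AL] L_scale[OF AL] intro!: subspaceI)
    then show ?thesis by (auto simp: invariant_under_def ker_def)
  qed
  show ?thesis
  proof (intro conjI impI)
    assume "\<not> lacunary (s_number A)"
    then obtain c where c: "c > 0" "\<And>n. c * s n \<le> s (Suc n)" using lacunary_iff by blast
    have "L \<subseteq> WE A"
    proof (intro subsetI in_WE_I)
      fix T and F G :: "'a set" assume "T \<in> L" "finite G"
      from E_approximation_if_ratio_bounded[OF system A rank c this]
      show "\<exists>S\<in>E A. \<forall>x\<in>F. \<forall>y\<in>G. ip (S x) y = ip (T x) y" by blast
    qed
    with WE_subset_L show "WE A = L" by blast
  next
    assume lacunary: "lacunary (s_number A)"
    show "WE A = {T \<in> L. invariant_under T (ker A)}"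
    proof (intro equalityI subsetI)
      fix T assume T: "T \<in> WE A"
      have "A (T x) = 0" if "A x = 0" for x
      proof (rule ccontr)
        assume "A (T x) \<noteq> 0"
        \<comment> \<open>A nonzero coefficient against some \<open>e n\<close> witnesses that a
          vector lies outside \<open>ker A\<close>; it passes from \<open>T\<close> to a nearby
          \<open>S\<close> in \<open>E A\<close>.\<close>
        then obtain n where "ip (T x) (e n) \<noteq> 0" using system_ker_iff[OF system] by blast
        then obtain S where S: "S \<in> E A" "ip (S x) (e n) \<noteq> 0" by (rule in_WE_D[OF T])
        from S(2) have "A (S x) \<noteq> 0" using system_ker_iff[OF system] by blast
        from ratio_bounded_if_ker_not_invariant[OF system S(1) that this]
        show False using lacunary lacunary_iff by simp
      qed
      then show "T \<in> {T \<in> L. invariant_under T (ker A)}"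
        using T WE_subset_L invariant_iff by blast
    next
      fix T assume "T \<in> {T \<in> L. invariant_under T (ker A)}"
      then have T: "T \<in> L" "\<And>x. A x = 0 \<Longrightarrow> A (T x) = 0" using invariant_iff by blast+
      show "T \<in> WE A"
        by (rule in_WE_I[OF T(1) E_approximation_if_ker_invariant[OF system T]])
    qed
  qed
qed

end

theorem theorem9p6:
  fixes scale :: "'k::real_or_complex \<Rightarrow> 'a::{real_inner,complete_space} \<Rightarrow> 'a"
    and ip :: "'a \<Rightarrow> 'a \<Rightarrow> 'k"
    and A :: "'a \<Rightarrow> 'a"
  assumes "hilbert_space scale ip"
    and "separable_space (euclidean :: 'a topology)"
    and "hilbert_space.compact_operator scale A"
    and "\<not> hilbert_space.finite_dimensional scale (range A)"
  shows "(\<not> lacunary (hilbert_space.s_number scale ip A) \<longrightarrow>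
            hilbert_space.WE scale ip A = hilbert_space.L scale) \<and>
         (lacunary (hilbert_space.s_number scale ip A) \<longrightarrow>
            hilbert_space.WE scale ip A =
              {T \<in> hilbert_space.L scale.
                 hilbert_space.invariant_under scale T (hilbert_space.ker A)})"
proof -
  interpret hilbert_space scale ip by fact
  show ?thesis using assms(3,4) by (rule WE_eq)
qed

end
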